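(* There exist universal constants $0<c\le C<\infty$ such that the following holds. Let $P\neq Q$ be probability measures on a measurable space $(\mathsf X,\mathcal F)$ and let $0<\delta\le 1/2$. Let $u=\frac{\mathrm d(P-Q)}{\mathrm d(P+Q)}$, let $X$ be a random variable with distribution $\frac{P+Q}{2}$, and set $U=u(X)$. Let $$ n_\delta(P,Q):=\min\bigl\{n\ge 1:\ \mathrm{TV}(P^{\otimes n},Q^{\otimes n})\ge\delta\bigr\}. $$ Then $$ c\,\max\left\{1,\frac{\delta^2}{\mathbb E\min\{U^2,\delta|U|\}}\right\} \le n_\delta(P,Q)\le C\,\max\left\{1,\frac{\delta^2}{\mathbb E\min\{U^2,\delta|U|\}}\right\}. $$
   Context: For probability measures $P,Q$ on a measurable space $(\mathsf X,\mathcal F)$, the total variation distance is $\mathrm{TV}(P,Q):=\sup_{B\in\mathcal F}|P(B)-Q(B)|$. $P^{\otimes n}$ is the $n$-fold product measure. The function $u=\frac{\mathrm d(P-Q)}{\mathrm d(P+Q)}$ is the Radon–Nikodym derivative of the signed measure $P-Q$ with respect to the measure $P+Q$. The quantity $n_\delta(P,Q)$ is the sample complexity of equal-prior binary hypothesis testing between $P$ and $Q$ with success probability at least $(1+\delta)/2$; $n$ ranges over positive integers. "Universal constants" means that $c,C$ do not depend on $\delta$, on the space, or on $P,Q$. *)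

theory Defs
  imports "HOL-Probability.Probability"
begin

text \<open>The supremum ranges over the common sigma-algebra; the definition is only meaningful
  when \<open>sets P = sets Q\<close>.\<close>
definition tv_dist :: "'a measure \<Rightarrow> 'a measure \<Rightarrow> real" where
  "tv_dist P Q = (SUP B\<in>sets P. \<bar>measure P B - measure Q B\<bar>)"

abbreviation product_power :: "'a measure \<Rightarrow> nat \<Rightarrow> (nat \<Rightarrow> 'a) measure" where
  "product_power P n \<equiv> (\<Pi>\<^sub>M i\<in>{..<n}. P)"

definition measure_add :: "'a measure \<Rightarrow> 'a measure \<Rightarrow> 'a measure" where
  "measure_add P Q = measure_of (space P) (sets P) (\<lambda>B. emeasure P B + emeasure Q B)"

lemma space_measure_add [simp]: "space (measure_add P Q) = space P"
  by (simp add: measure_add_def)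

lemma sets_measure_add [simp, measurable_cong]: "sets (measure_add P Q) = sets P"
  by (simp add: measure_add_def)

text \<open>\<open>measure_of\<close> silently yields the zero measure unless the given set function is
  countably additive; this lemma confirms that it is.\<close>
lemma emeasure_measure_add:
  assumes "sets P = sets Q" "B \<in> sets P"
  shows "emeasure (measure_add P Q) B = emeasure P B + emeasure Q B"
proof (rule emeasure_measure_of[OF measure_add_def])
  show "sets P \<subseteq> Pow (space P)"
    by (rule sets.space_closed)
  show "positive (sets (measure_add P Q)) (\<lambda>B. emeasure P B + emeasure Q B)"
    by (simp add: positive_def)
  show "countably_additive (sets (measure_add P Q)) (\<lambda>B. emeasure P B + emeasure Q B)"
  proof (rule countably_additiveI)
    fix A :: "nat \<Rightarrow> 'a set"
    assume A: "range A \<subseteq> sets (measure_add P Q)" "disjoint_family A"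
    then have "(\<Sum>i. emeasure P (A i)) = emeasure P (\<Union>i. A i)"
      "(\<Sum>i. emeasure Q (A i)) = emeasure Q (\<Union>i. A i)"
      using assms(1) by (auto intro!: suminf_emeasure)
    then show "(\<Sum>i. emeasure P (A i) + emeasure Q (A i))
        = emeasure P (\<Union>i. A i) + emeasure Q (\<Union>i. A i)"
      by (simp add: suminf_add[symmetric])
  qed
  show "B \<in> sets (measure_add P Q)"
    using assms(2) by simp
qed

text \<open>\<open>u\<close> is a version of the Radon-Nikodym derivative of the signed measure \<open>P - Q\<close>
  with respect to \<open>M\<close>; the library's \<open>RN_deriv\<close> covers nonnegative measures only.\<close>
definition RN_deriv_diff ::
    "'a measure \<Rightarrow> 'a measure \<Rightarrow> 'a measure \<Rightarrow> ('a \<Rightarrow> real) \<Rightarrow> bool" where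
  "RN_deriv_diff M P Q u \<longleftrightarrow>
     integrable M u \<and>
     (\<forall>B\<in>sets M. measure P B - measure Q B = set_lebesgue_integral M B u)"

definition enough_samples :: "real \<Rightarrow> 'a measure \<Rightarrow> 'a measure \<Rightarrow> nat \<Rightarrow> bool" where
  "enough_samples \<delta> P Q n \<longleftrightarrow>
     1 \<le> n \<and> \<delta> \<le> tv_dist (product_power P n) (product_power Q n)"

text \<open>Meaningful only if some \<open>n\<close> is enough; the theorem asserts this separately.\<close>
definition sample_complexity :: "real \<Rightarrow> 'a measure \<Rightarrow> 'a measure \<Rightarrow> nat" where
  "sample_complexity \<delta> P Q = (LEAST n. enough_samples \<delta> P Q n)"

text \<open>HOL cannot quantify over types below an existential quantifier, so in
  \<open>\<exists>c C. \<forall>P :: 'a measure. \<dots>\<close> the constants could still vary with the type \<open>'a\<close>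
  of the sample space. Requiring them to lie in a fixed compact subinterval of the positive reals,
  described by a constant without type variables, makes them universal: the endpoints then serve
  simultaneously for all types. The values are deliberately crude.\<close>
definition universal_range :: "real set" where
  "universal_range = {1 / 10 ^ 4 .. 10 ^ 4}"

end

theory Submission
  imports Defs
begin

text \<open>
  Let \<open>R = (P + Q) / 2\<close>. With respect to \<open>R\<close> the measures \<open>P\<close> and \<open>Q\<close> have the densities \<open>1 + u\<close> and
  \<open>1 - u\<close>, where \<open>u\<close> has values in \<open>[-1, 1]\<close> and mean zero. Let \<open>V = E min (U\<^sup>2) (\<delta> * \<bar>U\<bar>)\<close>, called the
  capped energy below. The theorem says that the total variation distance of the \<open>n\<close>-fold powers
  reaches \<open>\<delta>\<close> when \<open>n * V\<close> is of order \<open>\<delta>\<^sup>2\<close>.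

  If \<open>n * V \<le> \<delta>\<^sup>2 / 100\<close>, the distance is at most \<open>\<delta> / 2\<close> (\<open>tv_small_if_few_samples\<close>). Set \<open>u\<close> to zero
  where \<open>\<bar>u\<bar> > \<delta>\<close>. The mass that this discards is at most \<open>V / \<delta>\<close> in each coordinate, hence at most
  \<open>\<delta> / 100\<close> in total, and it bounds the effect on the product densities in L1 (\<open>truncation_cost\<close>). The
  truncated function has second moment at most \<open>V\<close>, so the products of \<open>1 + v\<close> and of \<open>1 - v\<close> for the truncated
  function \<open>v\<close> are close in L2, with squared distance of order \<open>n * V\<close> (\<open>truncated_products_close\<close>).

  If \<open>n * V \<ge> 200 * \<delta>\<^sup>2\<close>, the distance is at least \<open>\<delta>\<close> (\<open>tv_large_if_many_samples\<close>). The test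
  statistic is the sum of the values of \<open>u\<close> clipped to \<open>[-\<delta>, \<delta>]\<close>. Since \<open>u\<close> times its clipped
  version is \<open>min (u\<^sup>2) (\<delta> * \<bar>u\<bar>)\<close>, the mean of the sum differs by \<open>2 * n * V\<close> between the hypotheses,
  while its variance is at most \<open>2 * n * V\<close>. For small \<open>\<delta>\<close> the shift of the mean is small compared with the standard
  deviation, and Chebyshev's inequality alone does not detect it. Instead, a piecewise linear
  monotone function of the sum is integrated, and the samples from \<open>Q\<close> are
  replaced by samples from \<open>P\<close> one at a time. By monotonicity no replacement
  decreases the integral (\<open>ramp_gain\<close>), and Chebyshev's inequality is needed only to ensure that the sum of the
  other coordinates lies, with probability \<open>3 / 4\<close>, in the region where the
  function is linear and the increase is proportional to \<open>V\<close> (\<open>hybrid_concentration\<close>). Clipping at \<open>\<delta>\<close> makes a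
  single sample negligible on the scale of that region.

  Together these give the constants \<open>c = 1 / 100\<close> and \<open>C = 201\<close>.
\<close>

section \<open>Symmetric pairs of densities and their powers\<close>

definition tilt :: "'a measure \<Rightarrow> ('a \<Rightarrow> real) \<Rightarrow> 'a measure" where
  "tilt R u = density R (\<lambda>x. ennreal (1 + u x))"

lemma sets_tilt [simp, measurable_cong]: "sets (tilt R u) = sets R"
  by (simp add: tilt_def)

lemma space_tilt [simp]: "space (tilt R u) = space R"
  by (simp add: tilt_def)

definition capped_energy :: "'a measure \<Rightarrow> real \<Rightarrow> ('a \<Rightarrow> real) \<Rightarrow> real" where
  "capped_energy R \<delta> u = (\<integral>x. min ((u x)\<^sup>2) (\<delta> * \<bar>u x\<bar>) \<partial>R)"

text \<open>A product of measures with densities has the product of the densities: both sides agree on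
  rectangles, where the integral of a product of one-coordinate factors splits.\<close>
lemma PiM_density:
  fixes g :: "'a \<Rightarrow> real" and I :: "'i set"
  assumes R: "prob_space R" and D: "prob_space (density R (\<lambda>x. ennreal (g x)))"
    and I: "finite I" and g [measurable]: "g \<in> borel_measurable R" and g0: "\<And>x. 0 \<le> g x"
  shows "(\<Pi>\<^sub>M i\<in>I. density R (\<lambda>x. ennreal (g x)))
    = density (\<Pi>\<^sub>M i\<in>I. R) (\<lambda>x. ennreal (\<Prod>i\<in>I. g (x i)))"
proof -
  interpret R: product_sigma_finite "\<lambda>i::'i. R"
    using R by (simp add: product_sigma_finite_def prob_space_imp_sigma_finite)
  interpret D: product_sigma_finite "\<lambda>i::'i. density R (\<lambda>x. ennreal (g x))"
    using D by (simp add: product_sigma_finite_def prob_space_imp_sigma_finite)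
  show ?thesis
  proof (rule D.PiM_eqI[symmetric, OF I])
    show "sets (density (\<Pi>\<^sub>M i\<in>I. R) (\<lambda>x. ennreal (\<Prod>i\<in>I. g (x i))))
      = sets (\<Pi>\<^sub>M i\<in>I. density R (\<lambda>x. ennreal (g x)))"
      by (simp, rule sets_PiM_cong) auto
  next
    fix A :: "'i \<Rightarrow> 'a set"
    assume "\<And>i. i \<in> I \<Longrightarrow> A i \<in> sets (density R (\<lambda>x. ennreal (g x)))"
    then have A [measurable]: "\<And>i. i \<in> I \<Longrightarrow> A i \<in> sets R"
      by simp
    have "emeasure (density (\<Pi>\<^sub>M i\<in>I. R) (\<lambda>x. ennreal (\<Prod>i\<in>I. g (x i)))) (Pi\<^sub>E I A)
      = (\<integral>\<^sup>+x. ennreal (\<Prod>i\<in>I. g (x i)) * indicator (Pi\<^sub>E I A) x \<partial>(\<Pi>\<^sub>M i\<in>I. R))"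
      using I A by (intro emeasure_density) (auto intro!: sets_PiM_I_finite)
    also have "\<dots> = (\<integral>\<^sup>+x. (\<Prod>i\<in>I. ennreal (g (x i)) * indicator (A i) (x i)) \<partial>(\<Pi>\<^sub>M i\<in>I. R))"
    proof (rule nn_integral_cong)
      fix x assume "x \<in> space (\<Pi>\<^sub>M i\<in>I. R)"
      then have "indicator (Pi\<^sub>E I A) x = (\<Prod>i\<in>I. indicator (A i) (x i) :: ennreal)"
        using I by (auto simp: indicator_def space_PiM PiE_def Pi_def prod_zero_iff)
      then show "ennreal (\<Prod>i\<in>I. g (x i)) * indicator (Pi\<^sub>E I A) x
        = (\<Prod>i\<in>I. ennreal (g (x i)) * indicator (A i) (x i))"
        by (simp add: prod.distrib prod_ennreal g0)
    qed
    also have "\<dots> = (\<Prod>i\<in>I. \<integral>\<^sup>+x. ennreal (g x) * indicator (A i) x \<partial>R)"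
      using I by (subst R.product_nn_integral_prod) auto
    also have "\<dots> = (\<Prod>i\<in>I. emeasure (density R (\<lambda>x. ennreal (g x))) (A i))"
      by (intro prod.cong refl) (auto simp: emeasure_density)
    finally show "emeasure (density (\<Pi>\<^sub>M i\<in>I. R) (\<lambda>x. ennreal (\<Prod>i\<in>I. g (x i)))) (Pi\<^sub>E I A)
      = (\<Prod>i\<in>I. emeasure (density R (\<lambda>x. ennreal (g x))) (A i))" .
  qed
qed

text \<open>For \<open>R = (P + Q) / 2\<close> the pair \<open>P, Q\<close> is determined by one function \<open>u\<close> with values in
  \<open>[-1, 1]\<close> and mean zero, namely \<open>P = tilt R u\<close> and \<open>Q = tilt R (- u)\<close>. Exchanging the two hypotheses
  is the substitution \<open>u \<mapsto> - u\<close>, so that every fact about \<open>P\<close> yields its twin for \<open>Q\<close>. The bound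
  on \<open>u\<close> is required everywhere, rather than almost everywhere, so that \<open>1 + u\<close> is a density pointwise.\<close>
locale symmetric_tilt = prob_space R for R :: "'a measure" +
  fixes u :: "'a \<Rightarrow> real"
  assumes u_measurable [measurable]: "u \<in> borel_measurable R"
    and u_bound: "\<bar>u x\<bar> \<le> 1"
    and u_centered: "(\<integral>x. u x \<partial>R) = 0"
begin

lemma integrable_bounded:
  fixes f :: "'a \<Rightarrow> real"
  assumes "f \<in> borel_measurable R" "\<And>x. \<bar>f x\<bar> \<le> K"
  shows "integrable R f"
  using assms by (intro integrable_const_bound[where B = K]) auto

lemma integrable_u: "integrable R u"
  using u_bound by (intro integrable_bounded[where K = 1]) auto

lemma one_plus_u_nonneg: "0 \<le> 1 + u x"
  using u_bound[of x] by linarith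

lemma symmetric_tilt_minus: "symmetric_tilt R (\<lambda>x. - u x)"
  using u_bound u_centered by unfold_locales auto

lemma prob_space_tilt: "prob_space (tilt R u)"
proof
  have "(\<integral>\<^sup>+x. ennreal (1 + u x) \<partial>R) = ennreal (\<integral>x. 1 + u x \<partial>R)"
    using one_plus_u_nonneg integrable_u by (intro nn_integral_eq_integral) auto
  also have "\<dots> = 1"
    using integrable_u u_centered by (simp add: prob_space)
  finally show "emeasure (tilt R u) (space (tilt R u)) = 1"
    by (simp add: tilt_def emeasure_density cong: nn_integral_cong)
qed

lemma integral_tilt:
  fixes f :: "'a \<Rightarrow> real"
  assumes "f \<in> borel_measurable R"
  shows "(\<integral>x. f x \<partial>tilt R u) = (\<integral>x. (1 + u x) * f x \<partial>R)"
  using assms one_plus_u_nonneg unfolding tilt_def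
  by (subst integral_real_density) auto

lemma product_power_tilt:
  "product_power (tilt R u) n
    = density (product_power R n) (\<lambda>x. ennreal (\<Prod>i<n. 1 + u (x i)))"
  unfolding tilt_def
  using prob_space_axioms prob_space_tilt one_plus_u_nonneg
  by (intro PiM_density) (auto simp: tilt_def)

lemma capped_energy_nonneg: "0 \<le> \<delta> \<Longrightarrow> 0 \<le> capped_energy R \<delta> u"
  unfolding capped_energy_def by (intro Bochner_Integration.integral_nonneg) auto

end

section \<open>Elementary inequalities\<close>

text \<open>Expanding both products around \<open>b\<close> gives
  \<open>prod a - prod b = (\<Sum>S \<noteq> {}. (\<Prod>i\<in>S. a i - b i) * (\<Prod>i\<notin>S. b i))\<close>. The triangle inequality makes
  every factor \<open>a i - b i\<close> absolute, and the same expansion read backwards gives the right-hand side. Its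
  advantage is that it is a difference of products, so independent coordinates can be integrated
  separately.\<close>
lemma abs_prod_diff_le:
  fixes a b :: "'i \<Rightarrow> real"
  assumes "finite I" "\<And>i. 0 \<le> a i" "\<And>i. 0 \<le> b i"
  shows "\<bar>(\<Prod>i\<in>I. a i) - (\<Prod>i\<in>I. b i)\<bar> \<le> (\<Prod>i\<in>I. b i + \<bar>a i - b i\<bar>) - (\<Prod>i\<in>I. b i)"
  using assms(1)
proof (induction I)
  case (insert i I)
  let ?A = "\<Prod>j\<in>I. a j" and ?B = "\<Prod>j\<in>I. b j" and ?C = "\<Prod>j\<in>I. b j + \<bar>a j - b j\<bar>"
  have B: "0 \<le> ?B"
    using assms by (simp add: prod_nonneg)
  have "\<bar>a i * ?A - b i * ?B\<bar> = \<bar>a i * (?A - ?B) + (a i - b i) * ?B\<bar>"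
    by (simp add: algebra_simps)
  also have "\<dots> \<le> a i * \<bar>?A - ?B\<bar> + \<bar>a i - b i\<bar> * ?B"
    using abs_triangle_ineq[of "a i * (?A - ?B)" "(a i - b i) * ?B"] assms B by (simp add: abs_mult)
  also have "\<dots> \<le> (b i + \<bar>a i - b i\<bar>) * (?C - ?B) + \<bar>a i - b i\<bar> * ?B"
    using insert.IH assms B by (intro add_mono mult_mono) auto
  also have "\<dots> = (b i + \<bar>a i - b i\<bar>) * ?C - b i * ?B"
    by (simp add: algebra_simps)
  finally show ?case
    using insert.hyps by simp
qed simp

lemma power_diff_le:
  fixes x y :: real
  assumes "0 \<le> y" "y \<le> x" "1 \<le> x"
  shows "x ^ n - y ^ n \<le> real n * (x - y) * x ^ n"
proof (induction n)
  case (Suc n)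
  have "x ^ Suc n - y ^ Suc n = x * (x ^ n - y ^ n) + (x - y) * y ^ n"
    by (simp add: algebra_simps)
  also have "\<dots> \<le> x * (real n * (x - y) * x ^ n) + (x - y) * (x * x ^ n)"
  proof (intro add_mono mult_left_mono)
    have "y ^ n \<le> x ^ n"
      using assms by (intro power_mono) auto
    also have "x ^ n \<le> x * x ^ n"
      using assms by simp
    finally show "y ^ n \<le> x * x ^ n" .
  qed (use assms Suc.IH in auto)
  also have "\<dots> = real (Suc n) * (x - y) * x ^ Suc n"
    by (simp add: algebra_simps)
  finally show ?case .
qed simp

text \<open>This is nonnegativity of the variance of \<open>\<bar>Z\<bar>\<close>.\<close>
lemma (in prob_space) square_integral_abs_le:
  fixes Z :: "'a \<Rightarrow> real"
  assumes Z: "integrable M Z" and Z2: "integrable M (\<lambda>x. (Z x)\<^sup>2)"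
  shows "(\<integral>x. \<bar>Z x\<bar> \<partial>M)\<^sup>2 \<le> (\<integral>x. (Z x)\<^sup>2 \<partial>M)"
  using variance_eq[of "\<lambda>x. \<bar>Z x\<bar>"] variance_positive[of "\<lambda>x. \<bar>Z x\<bar>"] Z Z2 by simp

lemma exp_le_quadratic:
  fixes z :: real
  assumes "\<bar>z\<bar> \<le> 1"
  shows "exp z \<le> 1 + z + z\<^sup>2"
proof (cases "0 \<le> z")
  case True
  then show ?thesis
    using assms by (intro exp_bound) auto
next
  case False
  \<comment> \<open>The Taylor bound holds for positive arguments, so it is applied to \<open>- z\<close> and inverted.\<close>
  then have "1 + (- z) + (- z)\<^sup>2 / 2 \<le> exp (- z)"
    by (intro exp_lower_Taylor_quadratic) auto
  moreover have "0 < 1 + (- z) + (- z)\<^sup>2 / 2"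
    using False by (intro add_pos_nonneg) auto
  ultimately have "exp z \<le> 1 / (1 + (- z) + (- z)\<^sup>2 / 2)"
    by (simp add: exp_minus field_simps)
  also have "\<dots> \<le> 1 + z + z\<^sup>2"
  proof -
    have "(1 + z + z\<^sup>2) * (1 + (- z) + (- z)\<^sup>2 / 2) = 1 + z\<^sup>2 / 2 * (1 - z + z\<^sup>2)"
      by (simp add: field_simps power2_eq_square)
    moreover have "0 \<le> z\<^sup>2 / 2 * (1 - z + z\<^sup>2)"
      using False by (intro mult_nonneg_nonneg add_nonneg_nonneg) auto
    ultimately have "1 \<le> (1 + z + z\<^sup>2) * (1 + (- z) + (- z)\<^sup>2 / 2)"
      by simp
    then show ?thesis
      using \<open>0 < 1 + (- z) + (- z)\<^sup>2 / 2\<close> by (simp add: pos_divide_le_eq)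
  qed
  finally show ?thesis .
qed

section \<open>Too few samples leave the powers close\<close>

context symmetric_tilt
begin

definition truncated :: "real \<Rightarrow> 'a \<Rightarrow> real" where
  "truncated \<delta> x = (if \<bar>u x\<bar> \<le> \<delta> then u x else 0)"

lemma truncated_measurable [measurable]: "truncated \<delta> \<in> borel_measurable R"
  unfolding truncated_def by measurable

lemma truncated_bound: "\<bar>truncated \<delta> x\<bar> \<le> 1"
  using u_bound[of x] by (simp add: truncated_def)

lemma integrable_truncated: "integrable R (truncated \<delta>)"
  using truncated_bound by (intro integrable_bounded[where K = 1]) auto

lemma integrable_truncated_square: "integrable R (\<lambda>x. (truncated \<delta> x)\<^sup>2)"
  using truncated_bound by (intro integrable_bounded[where K = 1]) (auto simp: power_le_one_iff abs_square_le_1)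

lemma integrable_capped:
  assumes "0 \<le> \<delta>"
  shows "integrable R (\<lambda>x. min ((u x)\<^sup>2) (\<delta> * \<bar>u x\<bar>))"
proof (intro integrable_bounded[where K = 1])
  fix x
  have "(u x)\<^sup>2 \<le> 1"
    using u_bound[of x] by (simp add: abs_square_le_1)
  then show "\<bar>min ((u x)\<^sup>2) (\<delta> * \<bar>u x\<bar>)\<bar> \<le> 1"
    using assms by (auto simp: min_def)
qed measurable

text \<open>The two regimes of the minimum \<open>min (u\<^sup>2) (\<delta> * \<bar>u\<bar>)\<close> are separated by \<open>\<bar>u\<bar> = \<delta>\<close>: where \<open>u\<close> is
  kept, the quadratic term is the smaller one, and it controls the second moment of the truncation;
  where \<open>u\<close> is discarded, the linear term is the smaller one, and it controls the discarded mass.\<close>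
lemma truncated_square_le:
  assumes "0 \<le> \<delta>"
  shows "(\<integral>x. (truncated \<delta> x)\<^sup>2 \<partial>R) \<le> capped_energy R \<delta> u"
  unfolding capped_energy_def
proof (intro integral_mono integrable_truncated_square integrable_capped assms)
  fix x
  have "\<bar>u x\<bar> * \<bar>u x\<bar> \<le> \<delta> * \<bar>u x\<bar>" if "\<bar>u x\<bar> \<le> \<delta>"
    using that by (intro mult_right_mono) auto
  then show "(truncated \<delta> x)\<^sup>2 \<le> min ((u x)\<^sup>2) (\<delta> * \<bar>u x\<bar>)"
    using assms by (auto simp: truncated_def power2_eq_square)
qed

lemma truncation_error_le:
  assumes "0 \<le> \<delta>"
  shows "\<delta> * (\<integral>x. \<bar>u x - truncated \<delta> x\<bar> \<partial>R) \<le> capped_energy R \<delta> u"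
proof -
  have "(\<integral>x. \<delta> * \<bar>u x - truncated \<delta> x\<bar> \<partial>R) \<le> capped_energy R \<delta> u"
    unfolding capped_energy_def
  proof (intro integral_mono integrable_capped assms)
    show "integrable R (\<lambda>x. \<delta> * \<bar>u x - truncated \<delta> x\<bar>)"
      using integrable_u integrable_truncated by auto
    fix x
    have "\<delta> * \<bar>u x\<bar> \<le> \<bar>u x\<bar> * \<bar>u x\<bar>" if "\<delta> < \<bar>u x\<bar>"
      using that by (intro mult_right_mono) auto
    then show "\<delta> * \<bar>u x - truncated \<delta> x\<bar> \<le> min ((u x)\<^sup>2) (\<delta> * \<bar>u x\<bar>)"
      using assms by (auto simp: truncated_def power2_eq_square)
  qed
  then show ?thesis
    by simp
qed

lemma truncation_budget:
  assumes \<delta>: "0 < \<delta>" and n: "real n * capped_energy R \<delta> u \<le> \<delta>\<^sup>2 / 100"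
  shows "real n * (\<integral>x. \<bar>u x - truncated \<delta> x\<bar> \<partial>R) \<le> \<delta> / 100"
proof -
  have "real n * (\<delta> * (\<integral>x. \<bar>u x - truncated \<delta> x\<bar> \<partial>R)) \<le> real n * capped_energy R \<delta> u"
    using truncation_error_le[of \<delta>] \<delta> by (intro mult_left_mono) auto
  also have "\<dots> \<le> \<delta> * (\<delta> / 100)"
    using n by (simp add: power2_eq_square)
  finally have "\<delta> * (real n * (\<integral>x. \<bar>u x - truncated \<delta> x\<bar> \<partial>R)) \<le> \<delta> * (\<delta> / 100)"
    by (simp only: mult.left_commute)
  then show ?thesis
    using \<delta> by simp
qed

text \<open>The truncation need not be centered, but its mean is the negative of what was cut off
  from the centered function \<open>u\<close>.\<close>
lemma truncated_mean_le: "\<bar>\<integral>x. truncated \<delta> x \<partial>R\<bar> \<le> (\<integral>x. \<bar>u x - truncated \<delta> x\<bar> \<partial>R)"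
proof -
  have "\<bar>\<integral>x. truncated \<delta> x \<partial>R\<bar> = \<bar>\<integral>x. u x - truncated \<delta> x \<partial>R\<bar>"
    using integrable_u integrable_truncated u_centered by simp
  also have "\<dots> \<le> (\<integral>x. \<bar>u x - truncated \<delta> x\<bar> \<partial>R)"
    by (rule integral_abs_bound)
  finally show ?thesis .
qed

lemma prob_space_product_power: "prob_space (product_power R n)"
  using prob_space_axioms by (intro prob_space_PiM)

lemma
  fixes g :: "'a \<Rightarrow> real"
  assumes "integrable R g"
  shows integrable_product: "integrable (product_power R n) (\<lambda>x. \<Prod>i<n. g (x i))"
    and integral_product: "(\<integral>x. (\<Prod>i<n. g (x i)) \<partial>product_power R n) = (\<integral>x. g x \<partial>R) ^ n"
proof -
  interpret product_sigma_finite "\<lambda>_::nat. R"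
    by unfold_locales
  show "integrable (product_power R n) (\<lambda>x. \<Prod>i<n. g (x i))"
    using assms by (intro product_integrable_prod) auto
  show "(\<integral>x. (\<Prod>i<n. g (x i)) \<partial>product_power R n) = (\<integral>x. g x \<partial>R) ^ n"
    using assms by (subst product_integral_prod) auto
qed

text \<open>By the product inequality, the cost is at most \<open>(1 + m + \<eta>)^n - (1 + m)^n\<close>, where \<open>m\<close> is
  the mean of the truncation and \<open>\<eta>\<close> the discarded mass. This is about \<open>n * \<eta>\<close>, which is
  at most \<open>\<delta> / 100\<close>.\<close>
lemma truncation_cost:
  assumes \<delta>: "0 < \<delta>" "\<delta> \<le> 1 / 2" and n: "real n * capped_energy R \<delta> u \<le> \<delta>\<^sup>2 / 100"
  shows "(\<integral>x. \<bar>(\<Prod>i<n. 1 + u (x i)) - (\<Prod>i<n. 1 + truncated \<delta> (x i))\<bar> \<partial>product_power R n) \<le> \<delta> / 50"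
proof -
  let ?a = "\<lambda>y. 1 + u y" and ?b = "\<lambda>y. 1 + truncated \<delta> y"
  let ?d = "\<lambda>y. ?b y + \<bar>?a y - ?b y\<bar>"
  define m where "m = (\<integral>y. truncated \<delta> y \<partial>R)"
  define \<eta> where "\<eta> = (\<integral>y. \<bar>u y - truncated \<delta> y\<bar> \<partial>R)"
  have \<eta>0: "0 \<le> \<eta>"
    unfolding \<eta>_def by simp
  have m: "\<bar>m\<bar> \<le> \<eta>"
    unfolding m_def \<eta>_def by (rule truncated_mean_le)
  have int: "integrable R ?a" "integrable R ?b" "integrable R ?d"
    using integrable_u integrable_truncated by auto
  have nonneg: "0 \<le> ?a y" "0 \<le> ?b y" for y
    using u_bound[of y] truncated_bound[of \<delta> y] by linarith+
  have Eb: "(\<integral>y. ?b y \<partial>R) = 1 + m"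
    using integrable_truncated by (simp add: m_def prob_space)
  have Ed: "(\<integral>y. ?d y \<partial>R) = 1 + m + \<eta>"
    using integrable_truncated integrable_u by (simp add: m_def \<eta>_def prob_space)
  have n\<eta>: "real n * \<eta> \<le> \<delta> / 100"
    unfolding \<eta>_def by (rule truncation_budget[OF \<delta>(1) n])
  have b0: "0 \<le> 1 + m"
    unfolding Eb[symmetric] using nonneg by (intro Bochner_Integration.integral_nonneg) auto
  have "(\<integral>x. \<bar>(\<Prod>i<n. ?a (x i)) - (\<Prod>i<n. ?b (x i))\<bar> \<partial>product_power R n)
    \<le> (\<integral>x. (\<Prod>i<n. ?d (x i)) - (\<Prod>i<n. ?b (x i)) \<partial>product_power R n)"
  proof (intro integral_mono)
    fix x
    show "\<bar>(\<Prod>i<n. ?a (x i)) - (\<Prod>i<n. ?b (x i))\<bar> \<le> (\<Prod>i<n. ?d (x i)) - (\<Prod>i<n. ?b (x i))"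
      using nonneg by (intro abs_prod_diff_le) auto
  qed (intro integrable_abs Bochner_Integration.integrable_diff integrable_product int)+
  also have "\<dots> = (1 + m + \<eta>) ^ n - (1 + m) ^ n"
    by (subst Bochner_Integration.integral_diff)
      (simp_all only: integrable_product[OF int(2)] integrable_product[OF int(3)]
        integral_product[OF int(2)] integral_product[OF int(3)] Eb Ed)
  also have "\<dots> \<le> real n * \<eta> * (1 + m + \<eta>) ^ n"
    using power_diff_le[of "1 + m" "1 + m + \<eta>" n] b0 \<eta>0 m by simp
  also have "\<dots> \<le> \<delta> / 100 * 2"
  proof (intro mult_mono)
    have "(1 + m + \<eta>) ^ n \<le> exp (2 * \<eta>) ^ n"
    proof (rule power_mono)
      show "1 + m + \<eta> \<le> exp (2 * \<eta>)"
        using exp_ge_add_one_self[of "2 * \<eta>"] abs_le_D1[OF m] by linarith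
    qed (use b0 \<eta>0 in simp)
    also have "\<dots> = exp (2 * (real n * \<eta>))"
      by (simp add: exp_of_nat_mult[symmetric] mult_ac)
    also have "\<dots> \<le> 2"
    proof -
      have z: "0 \<le> 2 * (real n * \<eta>)" "2 * (real n * \<eta>) \<le> 1 / 2"
        using n\<eta> \<delta> \<eta>0 by auto
      then have "(2 * (real n * \<eta>))\<^sup>2 \<le> (1 / 2)\<^sup>2"
        by (intro power_mono)
      then show ?thesis
        using exp_le_quadratic[of "2 * (real n * \<eta>)"] z by (simp add: power2_eq_square)
    qed
    finally show "(1 + m + \<eta>) ^ n \<le> 2" .
  qed (use n\<eta> \<delta> \<eta>0 b0 in auto)
  finally show ?thesis
    by simp
qed

text \<open>After truncation the second moment is available. With \<open>m\<close> and \<open>s\<close> the first two moments of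
  the truncation, the squared L2 distance of the two product functions is
  \<open>(1 + s + 2 * m)^n + (1 + s - 2 * m)^n - 2 * (1 - s)^n\<close>. The terms linear in \<open>m\<close> cancel, and what
  remains is of order \<open>n * s + (n * m)\<^sup>2\<close>, hence a small multiple of \<open>\<delta>\<^sup>2\<close>. Without truncation the second
  moment of \<open>u\<close> could exceed the capped energy by a factor of up to \<open>1 / \<delta>\<close>.\<close>
lemma truncated_products_close:
  assumes \<delta>: "0 < \<delta>" "\<delta> \<le> 1 / 2" and n: "real n * capped_energy R \<delta> u \<le> \<delta>\<^sup>2 / 100"
  shows "(\<integral>x. \<bar>(\<Prod>i<n. 1 + truncated \<delta> (x i)) - (\<Prod>i<n. 1 - truncated \<delta> (x i))\<bar> \<partial>product_power R n)
    \<le> \<delta> / 4"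
proof -
  let ?v = "truncated \<delta>"
  let ?p = "\<lambda>y. 1 + ?v y" and ?q = "\<lambda>y. 1 - ?v y"
  let ?Z = "\<lambda>x. (\<Prod>i<n. ?p (x i)) - (\<Prod>i<n. ?q (x i))"
  interpret Rn: prob_space "product_power R n"
    by (rule prob_space_product_power)
  define m where "m = (\<integral>y. ?v y \<partial>R)"
  define s where "s = (\<integral>y. (?v y)\<^sup>2 \<partial>R)"
  define \<eta> where "\<eta> = (\<integral>y. \<bar>u y - ?v y\<bar> \<partial>R)"
  have m: "\<bar>m\<bar> \<le> \<eta>"
    unfolding m_def \<eta>_def by (rule truncated_mean_le)
  have "real n * \<eta> \<le> \<delta> / 100"
    unfolding \<eta>_def by (rule truncation_budget[OF \<delta>(1) n])
  moreover have "real n * \<bar>m\<bar> \<le> real n * \<eta>"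
    using m by (intro mult_left_mono) auto
  ultimately have nm: "real n * \<bar>m\<bar> \<le> \<delta> / 100"
    by linarith
  have s0: "0 \<le> s"
    unfolding s_def by simp
  have s1: "s \<le> 1"
  proof -
    have "(\<integral>y. (?v y)\<^sup>2 \<partial>R) \<le> (\<integral>y. 1 \<partial>R)"
      using truncated_bound by (intro integral_mono integrable_truncated_square) (auto simp: abs_square_le_1)
    then show ?thesis
      by (simp add: s_def prob_space)
  qed
  have "real n * s \<le> real n * capped_energy R \<delta> u"
    using truncated_square_le[of \<delta>] \<delta> by (simp add: s_def mult_left_mono)
  then have ns: "real n * s \<le> \<delta>\<^sup>2 / 100"
    using n by simp
  note int = integrable_truncated[of \<delta>] integrable_truncated_square[of \<delta>]
  have intp2: "integrable R (\<lambda>y. (?p y)\<^sup>2)" and intq2: "integrable R (\<lambda>y. (?q y)\<^sup>2)"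
    and intpq: "integrable R (\<lambda>y. 1 - (?v y)\<^sup>2)" and intpq1: "integrable R ?p" "integrable R ?q"
    using int by (auto simp: power2_sum power2_diff)
  have Ep2: "(\<integral>y. (?p y)\<^sup>2 \<partial>R) = 1 + s + 2 * m" and Eq2: "(\<integral>y. (?q y)\<^sup>2 \<partial>R) = 1 + s - 2 * m"
    and Epq: "(\<integral>y. 1 - (?v y)\<^sup>2 \<partial>R) = 1 - s"
    using int by (simp_all add: power2_sum power2_diff m_def s_def prob_space)
  have Z2: "(?Z x)\<^sup>2 = (\<Prod>i<n. (?p (x i))\<^sup>2) + (\<Prod>i<n. (?q (x i))\<^sup>2) - 2 * (\<Prod>i<n. 1 - (?v (x i))\<^sup>2)" for x
  proof -
    have "1 - (?v y)\<^sup>2 = ?p y * ?q y" for y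
      by (simp add: algebra_simps power2_eq_square)
    then show ?thesis
      by (simp add: power2_diff prod.distrib prod_power_distrib)
  qed
  have int_Z2: "integrable (product_power R n) (\<lambda>x. (?Z x)\<^sup>2)"
    unfolding Z2
    by (intro Bochner_Integration.integrable_diff Bochner_Integration.integrable_add
        integrable_mult_right integrable_product intp2 intq2 intpq)
  have int_Z: "integrable (product_power R n) ?Z"
    by (intro Bochner_Integration.integrable_diff integrable_product intpq1)
  have "(\<integral>x. \<bar>?Z x\<bar> \<partial>product_power R n)\<^sup>2 \<le> (\<integral>x. (?Z x)\<^sup>2 \<partial>product_power R n)"
    by (rule Rn.square_integral_abs_le[OF int_Z int_Z2])
  also have "\<dots> = (1 + s + 2 * m) ^ n + (1 + s - 2 * m) ^ n - 2 * (1 - s) ^ n"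
    unfolding Z2
    by (simp only: Bochner_Integration.integral_diff Bochner_Integration.integral_add
        Bochner_Integration.integrable_add integral_mult_right_zero integrable_mult_right
        integrable_product[OF intp2] integrable_product[OF intq2] integrable_product[OF intpq]
        integral_product[OF intp2] integral_product[OF intq2] integral_product[OF intpq] Ep2 Eq2 Epq)
  also have "\<dots> \<le> (\<delta> / 4)\<^sup>2"
  proof -
    define y where "y = real n * s"
    define z where "z = 2 * (real n * m)"
    have y: "0 \<le> y" "y \<le> \<delta>\<^sup>2 / 100"
      using ns s0 by (auto simp: y_def)
    have z: "\<bar>z\<bar> \<le> \<delta> / 50"
      using nm by (simp add: z_def abs_mult)
    have \<delta>2: "\<delta>\<^sup>2 \<le> \<delta> / 2" "\<delta>\<^sup>2 \<le> 1 / 4"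
      using \<delta> power_mono[of \<delta> "1 / 2" 2] by (auto simp: power2_eq_square power_divide)
    have e: "(1 + t) ^ n \<le> 1 + real n * t + (real n * t)\<^sup>2" if "0 \<le> 1 + t" "\<bar>real n * t\<bar> \<le> 1" for t
    proof -
      have "(1 + t) ^ n \<le> exp t ^ n"
        using that by (intro power_mono) auto
      also have "\<dots> = exp (real n * t)"
        by (simp add: exp_of_nat_mult)
      finally show ?thesis
        using exp_le_quadratic[OF that(2)] by simp
    qed
    have "0 \<le> (\<integral>y. (?p y)\<^sup>2 \<partial>R)" "0 \<le> (\<integral>y. (?q y)\<^sup>2 \<partial>R)"
      by simp_all
    then have pos: "0 \<le> 1 + (s + 2 * m)" "0 \<le> 1 + (s - 2 * m)"
      by (simp_all add: Ep2 Eq2)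
    have yz: "real n * (s + 2 * m) = y + z" "real n * (s - 2 * m) = y - z"
      by (simp_all add: y_def z_def algebra_simps)
    have small: "\<bar>y + z\<bar> \<le> 1" "\<bar>y - z\<bar> \<le> 1"
      using y z \<delta>2 \<delta> by linarith+
    have "(1 + s + 2 * m) ^ n \<le> 1 + (y + z) + (y + z)\<^sup>2"
      using e[of "s + 2 * m", OF pos(1)] small(1) by (simp add: yz add.assoc)
    moreover have "(1 + s - 2 * m) ^ n \<le> 1 + (y - z) + (y - z)\<^sup>2"
      using e[of "s - 2 * m", OF pos(2)] small(2) by (simp add: yz add_diff_eq)
    moreover have "1 - y \<le> (1 - s) ^ n"
      using Bernoulli_inequality[of "- s" n] s1 by (simp add: y_def)
    ultimately have "(1 + s + 2 * m) ^ n + (1 + s - 2 * m) ^ n - 2 * (1 - s) ^ n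
      \<le> 4 * y + 2 * y\<^sup>2 + 2 * z\<^sup>2"
      by (simp add: power2_sum power2_diff)
    also have "\<dots> \<le> 4 * (\<delta>\<^sup>2 / 100) + 2 * (\<delta>\<^sup>2 / 100) + 2 * (\<delta> / 50)\<^sup>2"
    proof (intro add_mono mult_left_mono)
      have "y * y \<le> y * 1"
        using y \<delta>2 by (intro mult_left_mono) auto
      then show "y\<^sup>2 \<le> \<delta>\<^sup>2 / 100"
        using y by (simp add: power2_eq_square)
      show "z\<^sup>2 \<le> (\<delta> / 50)\<^sup>2"
        using z \<delta> by (intro abs_le_square_iff[THEN iffD1]) auto
    qed (use y in auto)
    also have "\<dots> \<le> (\<delta> / 4)\<^sup>2"
      by (simp add: power_divide)
    finally show ?thesis .
  qed
  finally show ?thesis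
    by (rule power2_le_imp_le) (use \<delta> in simp)
qed

lemma integral_product_power_tilt:
  fixes f :: "(nat \<Rightarrow> 'a) \<Rightarrow> real"
  assumes "f \<in> borel_measurable (product_power R n)"
  shows "(\<integral>x. f x \<partial>product_power (tilt R u) n)
    = (\<integral>x. (\<Prod>i<n. 1 + u (x i)) * f x \<partial>product_power R n)"
  using assms one_plus_u_nonneg unfolding product_power_tilt
  by (subst integral_real_density) (auto intro!: prod_nonneg)

lemma measure_product_power_tilt:
  assumes "B \<in> sets (product_power R n)"
  shows "measure (product_power (tilt R u) n) B
    = (\<integral>x. (\<Prod>i<n. 1 + u (x i)) * indicator B x \<partial>product_power R n)"
proof -
  have "B \<in> sets (product_power (tilt R u) n)"
    using assms by (simp add: product_power_tilt)
  then have "measure (product_power (tilt R u) n) B = (\<integral>x. indicator B x \<partial>product_power (tilt R u) n)"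
    by (simp add: Int_absorb2 sets.sets_into_space)
  also have "\<dots> = (\<integral>x. (\<Prod>i<n. 1 + u (x i)) * indicator B x \<partial>product_power R n)"
    using assms by (intro integral_product_power_tilt) auto
  finally show ?thesis .
qed

text \<open>The L1 distance of the product densities is bounded along the path that truncates \<open>u\<close>, changes
  the sign of the truncation, and restores \<open>- u\<close>.\<close>
lemma tv_small_if_few_samples:
  assumes \<delta>: "0 < \<delta>" "\<delta> \<le> 1 / 2" and n: "real n * capped_energy R \<delta> u \<le> \<delta>\<^sup>2 / 100"
  shows "tv_dist (product_power (tilt R u) n) (product_power (tilt R (\<lambda>x. - u x)) n) \<le> \<delta> / 2"
proof -
  interpret neg: symmetric_tilt R "\<lambda>x. - u x"
    by (rule symmetric_tilt_minus)
  let ?Rn = "product_power R n"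
  let ?F = "\<lambda>x. \<Prod>i<n. 1 + u (x i)" and ?G = "\<lambda>x. \<Prod>i<n. 1 - u (x i)"
  let ?F' = "\<lambda>x. \<Prod>i<n. 1 + truncated \<delta> (x i)" and ?G' = "\<lambda>x. \<Prod>i<n. 1 - truncated \<delta> (x i)"
  have int: "integrable ?Rn ?F" "integrable ?Rn ?G" "integrable ?Rn ?F'" "integrable ?Rn ?G'"
    using integrable_u integrable_truncated by (auto intro!: integrable_product)
  have neg_truncated: "neg.truncated \<delta> = (\<lambda>x. - truncated \<delta> x)"
    by (auto simp: neg.truncated_def truncated_def)
  have "capped_energy R \<delta> (\<lambda>x. - u x) = capped_energy R \<delta> u"
    by (simp add: capped_energy_def)
  then have G: "(\<integral>x. \<bar>?G x - ?G' x\<bar> \<partial>?Rn) \<le> \<delta> / 50"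
    using neg.truncation_cost[OF \<delta>, of n] n by (simp add: neg_truncated)
  have F: "(\<integral>x. \<bar>?F x - ?F' x\<bar> \<partial>?Rn) \<le> \<delta> / 50"
    using truncation_cost[OF \<delta> n] .
  have FG: "(\<integral>x. \<bar>?F' x - ?G' x\<bar> \<partial>?Rn) \<le> \<delta> / 4"
    using truncated_products_close[OF \<delta> n] .
  have "(\<integral>x. \<bar>?F x - ?G x\<bar> \<partial>?Rn)
    \<le> (\<integral>x. \<bar>?F x - ?F' x\<bar> + \<bar>?F' x - ?G' x\<bar> + \<bar>?G x - ?G' x\<bar> \<partial>?Rn)"
    using int by (intro integral_mono) auto
  also have "\<dots> = (\<integral>x. \<bar>?F x - ?F' x\<bar> \<partial>?Rn) + (\<integral>x. \<bar>?F' x - ?G' x\<bar> \<partial>?Rn)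
      + (\<integral>x. \<bar>?G x - ?G' x\<bar> \<partial>?Rn)"
    using int by simp
  also have "\<dots> \<le> \<delta> / 2"
    using F G FG \<delta> by simp
  finally have L1: "(\<integral>x. \<bar>?F x - ?G x\<bar> \<partial>?Rn) \<le> \<delta> / 2" .
  show ?thesis
    unfolding tv_dist_def
  proof (rule cSUP_least)
    show "sets (product_power (tilt R u) n) \<noteq> {}"
      using sets.empty_sets[of "product_power (tilt R u) n"] by blast
    fix B assume "B \<in> sets (product_power (tilt R u) n)"
    then have B [measurable]: "B \<in> sets ?Rn"
      unfolding product_power_tilt by simp
    have FB: "measure (product_power (tilt R u) n) B = (\<integral>x. ?F x * indicator B x \<partial>?Rn)"
      using measure_product_power_tilt[OF B] .
    have GB: "measure (product_power (tilt R (\<lambda>x. - u x)) n) B = (\<integral>x. ?G x * indicator B x \<partial>?Rn)"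
      using neg.measure_product_power_tilt[OF B] by simp
    have "measure (product_power (tilt R u) n) B - measure (product_power (tilt R (\<lambda>x. - u x)) n) B
      = (\<integral>x. (?F x - ?G x) * indicator B x \<partial>?Rn)"
      unfolding FB GB left_diff_distrib using int B
      by (subst Bochner_Integration.integral_diff) (auto intro!: integrable_real_mult_indicator)
    also have "\<bar>\<dots>\<bar> \<le> (\<integral>x. \<bar>(?F x - ?G x) * indicator B x\<bar> \<partial>?Rn)"
      by (rule integral_abs_bound)
    also have "\<dots> \<le> (\<integral>x. \<bar>?F x - ?G x\<bar> \<partial>?Rn)"
      using int B by (intro integral_mono integrable_abs integrable_real_mult_indicator)
        (auto simp: indicator_def)
    finally show "\<bar>measure (product_power (tilt R u) n) B
      - measure (product_power (tilt R (\<lambda>x. - u x)) n) B\<bar> \<le> \<delta> / 2"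
      using L1 by simp
  qed
qed

end

section \<open>Tools for the test statistic\<close>

text \<open>Since the densities \<open>F\<close> and \<open>G\<close> have equal integrals, \<open>f\<close> may be replaced by \<open>f + 1\<close>, which lies
  between 0 and 2. Then the integral of \<open>(F - G) * (f + 1)\<close> is largest if \<open>f + 1\<close> is 2 on the set where
  \<open>G < F\<close> and 0 elsewhere.\<close>
lemma (in symmetric_tilt) integral_diff_le_tv_dist:
  fixes f :: "(nat \<Rightarrow> 'a) \<Rightarrow> real"
  assumes f [measurable]: "f \<in> borel_measurable (product_power R n)" and f1: "\<And>x. \<bar>f x\<bar> \<le> 1"
  shows "(\<integral>x. f x \<partial>product_power (tilt R u) n) - (\<integral>x. f x \<partial>product_power (tilt R (\<lambda>x. - u x)) n)
    \<le> 2 * tv_dist (product_power (tilt R u) n) (product_power (tilt R (\<lambda>x. - u x)) n)"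
proof -
  interpret neg: symmetric_tilt R "\<lambda>x. - u x"
    by (rule symmetric_tilt_minus)
  let ?Rn = "product_power R n" and ?Pn = "product_power (tilt R u) n"
    and ?Qn = "product_power (tilt R (\<lambda>x. - u x)) n"
  let ?F = "\<lambda>x. \<Prod>i<n. 1 + u (x i)" and ?G = "\<lambda>x. \<Prod>i<n. 1 - u (x i)"
  interpret Pn: prob_space ?Pn
    using prob_space_tilt by (intro prob_space_PiM)
  interpret Qn: prob_space ?Qn
    using neg.prob_space_tilt by (intro prob_space_PiM)
  have int1: "integrable R (\<lambda>x. 1 + u x)" "integrable R (\<lambda>x. 1 - u x)"
    using integrable_u by auto
  have int: "integrable ?Rn ?F" "integrable ?Rn ?G"
    using int1 by (auto intro!: integrable_product)
  have total: "(\<integral>x. ?F x \<partial>?Rn) = 1" "(\<integral>x. ?G x \<partial>?Rn) = 1"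
    using integral_product[OF int1(1), of n] integral_product[OF int1(2), of n]
      integrable_u u_centered by (simp_all add: prob_space)
  have intf: "integrable ?Rn (\<lambda>x. g x * f x)" if "integrable ?Rn g" for g
  proof (rule Bochner_Integration.integrable_bound[OF that])
    have "\<bar>g x\<bar> * \<bar>f x\<bar> \<le> \<bar>g x\<bar> * 1" for x
      using f1 by (intro mult_left_mono) auto
    then show "AE x in ?Rn. norm (g x * f x) \<le> norm (g x)"
      by (simp add: abs_mult)
  qed (use that in measurable)
  define B where "B = {x \<in> space ?Rn. ?G x < ?F x}"
  have B [measurable]: "B \<in> sets ?Rn"
    unfolding B_def by measurable
  have "(\<integral>x. f x \<partial>?Pn) - (\<integral>x. f x \<partial>?Qn) = (\<integral>x. ?F x * f x \<partial>?Rn) - (\<integral>x. ?G x * f x \<partial>?Rn)"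
    using integral_product_power_tilt[OF f] neg.integral_product_power_tilt[OF f] by simp
  also have "\<dots> = (\<integral>x. ?F x * f x - ?G x * f x \<partial>?Rn) + ((\<integral>x. ?F x \<partial>?Rn) - (\<integral>x. ?G x \<partial>?Rn))"
    using intf[OF int(1)] intf[OF int(2)] total by simp
  also have "\<dots> = (\<integral>x. (?F x * f x - ?G x * f x) + (?F x - ?G x) \<partial>?Rn)"
    using intf[OF int(1)] intf[OF int(2)] int by simp
  also have "\<dots> \<le> (\<integral>x. 2 * (?F x * indicator B x - ?G x * indicator B x) \<partial>?Rn)"
  proof (intro integral_mono)
    fix x assume x: "x \<in> space ?Rn"
    have f_range: "0 \<le> f x + 1" "f x + 1 \<le> 2"
      using f1[of x] by linarith+
    have "(?F x - ?G x) * (f x + 1) \<le> 2 * ((?F x - ?G x) * indicator B x)"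
    proof (cases "x \<in> B")
      case True
      then have "0 \<le> ?F x - ?G x"
        by (simp add: B_def)
      then have "(?F x - ?G x) * (f x + 1) \<le> (?F x - ?G x) * 2"
        using f_range by (intro mult_left_mono) auto
      then show ?thesis
        using True by simp
    next
      case False
      then have "?F x - ?G x \<le> 0"
        using x by (simp add: B_def)
      then show ?thesis
        using False f_range by (simp add: mult_nonpos_nonneg)
    qed
    then show "(?F x * f x - ?G x * f x) + (?F x - ?G x)
      \<le> 2 * (?F x * indicator B x - ?G x * indicator B x)"
      by (simp only: algebra_simps)
  qed (intro Bochner_Integration.integrable_add Bochner_Integration.integrable_diff
      integrable_mult_right intf int integrable_real_mult_indicator B)+
  also have "\<dots> = 2 * (measure ?Pn B - measure ?Qn B)"
    using measure_product_power_tilt[OF B] neg.measure_product_power_tilt[OF B] int B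
    by (simp add: integrable_real_mult_indicator)
  also have "\<dots> \<le> 2 * tv_dist ?Pn ?Qn"
  proof -
    have "\<bar>measure ?Pn A - measure ?Qn A\<bar> \<le> 1" for A
      using Pn.prob_le_1[of A] Qn.prob_le_1[of A] measure_nonneg[of ?Pn A] measure_nonneg[of ?Qn A]
      by linarith
    then have "bdd_above ((\<lambda>A. \<bar>measure ?Pn A - measure ?Qn A\<bar>) ` sets ?Pn)"
      by (intro bdd_aboveI2[where M = 1])
    moreover have "B \<in> sets ?Pn"
      using B by (simp add: product_power_tilt)
    ultimately have "\<bar>measure ?Pn B - measure ?Qn B\<bar> \<le> tv_dist ?Pn ?Qn"
      unfolding tv_dist_def by (intro cSUP_upper)
    then show ?thesis
      by simp
  qed
  finally show ?thesis .
qed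

text \<open>This is Fubini with the coordinate \<open>k\<close> integrated first. It serves to pass from a power of
  \<open>Q\<close> to a power of \<open>P\<close> by exchanging one coordinate at a time.\<close>
lemma integral_change_coordinate:
  fixes M N :: "'i \<Rightarrow> 'b measure" and f :: "('i \<Rightarrow> 'b) \<Rightarrow> real"
  assumes M: "\<And>i. prob_space (M i)" and N: "\<And>i. prob_space (N i)"
    and MN: "\<And>i. i \<in> I \<Longrightarrow> M i = N i" and sets_k: "sets (M k) = sets (N k)"
    and I: "finite I" "k \<notin> I"
    and f: "f \<in> borel_measurable (PiM (insert k I) M)" and f1: "\<And>x. \<bar>f x\<bar> \<le> K"
  defines "D \<equiv> \<lambda>x. (\<integral>y. f (x(k := y)) \<partial>M k) - (\<integral>y. f (x(k := y)) \<partial>N k)"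
  shows "(\<integral>x. f x \<partial>PiM (insert k I) M) - (\<integral>x. f x \<partial>PiM (insert k I) N) = (\<integral>x. D x \<partial>PiM I M)"
    and "integrable (PiM I M) D"
proof -
  interpret M: product_sigma_finite M
    using M by (simp add: product_sigma_finite_def prob_space_imp_sigma_finite)
  interpret N: product_sigma_finite N
    using N by (simp add: product_sigma_finite_def prob_space_imp_sigma_finite)
  have sets_insert: "sets (PiM (insert k I) M) = sets (PiM (insert k I) N)"
    using MN sets_k by (intro sets_PiM_cong) auto
  have fN: "f \<in> borel_measurable (PiM (insert k I) N)"
    using f by (simp only: measurable_cong_sets[OF sets_insert refl])
  have eq: "PiM I N = PiM I M"
    using MN by (intro PiM_cong) auto
  have add_dim: "(\<lambda>(x, y). f (x(k := y))) \<in> borel_measurable (PiM I L \<Otimes>\<^sub>M L k)"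
    if "f \<in> borel_measurable (PiM (insert k I) L)" for L :: "'i \<Rightarrow> 'b measure"
    using measurable_comp[OF measurable_add_dim that] by (simp add: comp_def case_prod_beta)
  have inner: "(\<lambda>x. \<integral>y. f (x(k := y)) \<partial>L k) \<in> borel_measurable (PiM I L)"
      "\<bar>\<integral>y. f (x(k := y)) \<partial>L k\<bar> \<le> K"
    if L: "f \<in> borel_measurable (PiM (insert k I) L)" "prob_space (L k)"
    for x and L :: "'i \<Rightarrow> 'b measure"
  proof -
    interpret Lk: prob_space "L k"
      by (rule L)
    show "(\<lambda>x. \<integral>y. f (x(k := y)) \<partial>L k) \<in> borel_measurable (PiM I L)"
      using Lk.borel_measurable_lebesgue_integral[OF add_dim[OF L(1)]] by simp
    have K: "0 \<le> K"
      using f1[of undefined] by linarith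
    show "\<bar>\<integral>y. f (x(k := y)) \<partial>L k\<bar> \<le> K"
    proof (cases "integrable (L k) (\<lambda>y. f (x(k := y)))")
      case True
      have "\<bar>\<integral>y. f (x(k := y)) \<partial>L k\<bar> \<le> (\<integral>y. \<bar>f (x(k := y))\<bar> \<partial>L k)"
        by (rule integral_abs_bound)
      also have "\<dots> \<le> K"
        using True f1 by (intro Lk.integral_le_const) auto
      finally show ?thesis .
    qed (use K in \<open>simp add: not_integrable_integral_eq\<close>)
  qed
  interpret PM: prob_space "PiM I M"
    using M by (intro prob_space_PiM)
  interpret PMk: prob_space "PiM (insert k I) M"
    using M by (intro prob_space_PiM)
  interpret PNk: prob_space "PiM (insert k I) N"
    using N by (intro prob_space_PiM)
  have intM: "integrable (PiM I M) (\<lambda>x. \<integral>y. f (x(k := y)) \<partial>M k)"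
    using inner[OF f M] by (intro PM.integrable_const_bound[where B = K]) auto
  have intN: "integrable (PiM I M) (\<lambda>x. \<integral>y. f (x(k := y)) \<partial>N k)"
    using inner[OF fN N] unfolding eq by (intro PM.integrable_const_bound[where B = K]) auto
  show "integrable (PiM I M) D"
    unfolding D_def using intM intN by simp
  have "(\<integral>x. f x \<partial>PiM (insert k I) M) = (\<integral>x. (\<integral>y. f (x(k := y)) \<partial>M k) \<partial>PiM I M)"
    using f f1 by (intro M.product_integral_insert I PMk.integrable_const_bound[where B = K]) auto
  moreover have "(\<integral>x. f x \<partial>PiM (insert k I) N) = (\<integral>x. (\<integral>y. f (x(k := y)) \<partial>N k) \<partial>PiM I M)"
    unfolding eq[symmetric]
    using fN f1 by (intro N.product_integral_insert I PNk.integrable_const_bound[where B = K]) auto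
  ultimately show "(\<integral>x. f x \<partial>PiM (insert k I) M) - (\<integral>x. f x \<partial>PiM (insert k I) N) = (\<integral>x. D x \<partial>PiM I M)"
    unfolding D_def using intM intN by simp
qed

text \<open>Variances of independent variables add. The distributions may differ between coordinates,
  since mixed products of \<open>P\<close> and \<open>Q\<close> occur below.\<close>
lemma second_moment_sum_le:
  fixes M :: "'i \<Rightarrow> 'b measure" and g :: "'i \<Rightarrow> 'b \<Rightarrow> real"
  assumes M: "\<And>i. prob_space (M i)" and I: "finite I"
    and g: "\<And>i. g i \<in> borel_measurable (M i)" and gK: "\<And>i x. \<bar>g i x\<bar> \<le> K"
    and centered: "\<And>i. (\<integral>x. g i x \<partial>M i) = 0" and var: "\<And>i. (\<integral>x. (g i x)\<^sup>2 \<partial>M i) \<le> s"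
  shows "(\<integral>x. (\<Sum>i\<in>I. g i (x i))\<^sup>2 \<partial>PiM I M) \<le> real (card I) * s"
    and "integrable (PiM I M) (\<lambda>x. (\<Sum>i\<in>I. g i (x i))\<^sup>2)"
proof -
  interpret M: product_sigma_finite M
    using M by (simp add: product_sigma_finite_def prob_space_imp_sigma_finite)
  have int: "integrable (PiM J M) (\<lambda>x. (\<Sum>i\<in>J. g i (x i))\<^sup>2)" if "finite J" for J
  proof -
    interpret PJ: prob_space "PiM J M"
      using M by (intro prob_space_PiM)
    have "\<bar>\<Sum>i\<in>J. g i (x i)\<bar> \<le> real (card J) * K" for x
      using sum_norm_bound[of J "\<lambda>i. g i (x i)" K] gK by simp
    then have "(\<Sum>i\<in>J. g i (x i))\<^sup>2 \<le> (real (card J) * K)\<^sup>2" for x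
      by (metis abs_ge_zero power2_abs power_mono)
    then show ?thesis
      using g by (intro PJ.integrable_const_bound[where B = "(real (card J) * K)\<^sup>2"]) auto
  qed
  then show "integrable (PiM I M) (\<lambda>x. (\<Sum>i\<in>I. g i (x i))\<^sup>2)"
    using I .
  show "(\<integral>x. (\<Sum>i\<in>I. g i (x i))\<^sup>2 \<partial>PiM I M) \<le> real (card I) * s"
    using I
  proof (induction I)
    case empty
    then show ?case by simp
  next
    case (insert k I)
    interpret PI: prob_space "PiM I M"
      using M by (intro prob_space_PiM)
    interpret Mk: prob_space "M k"
      by (rule M)
    let ?S = "\<lambda>x. \<Sum>i\<in>I. g i (x i)"
    have gk: "integrable (M k) (g k)" "integrable (M k) (\<lambda>y. (g k y)\<^sup>2)"
    proof -
      show "integrable (M k) (g k)"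
        using g gK by (intro Mk.integrable_const_bound[where B = K]) auto
      have "(g k y)\<^sup>2 \<le> K\<^sup>2" for y
        using gK[of k y] by (metis abs_ge_zero power2_abs power_mono)
      then show "integrable (M k) (\<lambda>y. (g k y)\<^sup>2)"
        using g by (intro Mk.integrable_const_bound[where B = "K\<^sup>2"]) auto
    qed
    have sum_upd: "(\<Sum>i\<in>insert k I. g i ((x(k := y)) i)) = ?S x + g k y" for x y
    proof -
      have "(\<Sum>i\<in>I. g i ((x(k := y)) i)) = ?S x"
        using insert.hyps by (intro sum.cong) auto
      then show ?thesis
        using insert.hyps by simp
    qed
    have "(\<integral>x. (\<Sum>i\<in>insert k I. g i (x i))\<^sup>2 \<partial>PiM (insert k I) M)
      = (\<integral>x. (\<integral>y. (?S x + g k y)\<^sup>2 \<partial>M k) \<partial>PiM I M)"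
      using M.product_integral_insert[OF insert.hyps int] insert.hyps by (simp only: sum_upd finite_insert)
    also have "\<dots> = (\<integral>x. (?S x)\<^sup>2 + (\<integral>y. (g k y)\<^sup>2 \<partial>M k) \<partial>PiM I M)"
      using gk centered by (simp add: power2_sum Mk.prob_space)
    also have "\<dots> = (\<integral>x. (?S x)\<^sup>2 \<partial>PiM I M) + (\<integral>y. (g k y)\<^sup>2 \<partial>M k)"
      using int[OF insert.hyps(1)] by (simp add: PI.prob_space)
    also have "\<dots> \<le> real (card I) * s + s"
      using insert.IH var by (intro add_mono)
    finally show ?case
      using insert.hyps by (simp add: algebra_simps)
  qed
qed

section \<open>Enough samples separate the powers\<close>

definition ramp :: "real \<Rightarrow> real" where
  "ramp t = max (- 1) (min 1 t)"

lemma ramp_measurable [measurable]: "ramp \<in> borel_measurable borel"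
  unfolding ramp_def by measurable

lemma ramp_bound: "\<bar>ramp t\<bar> \<le> 1"
  by (auto simp: ramp_def)

lemma ramp_mono: "s \<le> t \<Longrightarrow> ramp s \<le> ramp t"
  by (auto simp: ramp_def)

lemma ramp_eq: "\<bar>t\<bar> \<le> 1 \<Longrightarrow> ramp t = t"
  by (auto simp: ramp_def)

context symmetric_tilt
begin

definition clipped :: "real \<Rightarrow> 'a \<Rightarrow> real" where
  "clipped \<delta> x = max (- \<delta>) (min \<delta> (u x))"

lemma clipped_measurable [measurable]: "clipped \<delta> \<in> borel_measurable R"
  unfolding clipped_def by measurable

lemma clipped_bound: "0 \<le> \<delta> \<Longrightarrow> \<bar>clipped \<delta> x\<bar> \<le> \<delta>"
  by (auto simp: clipped_def)

text \<open>The statistic behind the theorem: the correlation of the clipped function with \<open>u\<close> is exactly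
  the capped energy, so the means of \<open>clipped \<delta>\<close> under the two hypotheses differ by twice that energy.\<close>
lemma u_times_clipped:
  assumes "0 \<le> \<delta>"
  shows "u x * clipped \<delta> x = min ((u x)\<^sup>2) (\<delta> * \<bar>u x\<bar>)"
proof (cases "\<bar>u x\<bar> \<le> \<delta>")
  case True
  then have "\<bar>u x\<bar> * \<bar>u x\<bar> \<le> \<delta> * \<bar>u x\<bar>"
    by (intro mult_right_mono) auto
  then show ?thesis
    using True by (simp add: clipped_def power2_eq_square)
next
  case False
  then have "\<delta> * \<bar>u x\<bar> < \<bar>u x\<bar> * \<bar>u x\<bar>"
    using assms by (intro mult_strict_right_mono) auto
  then have "min ((u x)\<^sup>2) (\<delta> * \<bar>u x\<bar>) = \<delta> * \<bar>u x\<bar>"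
    by (simp add: power2_eq_square min_def)
  moreover have "u x * clipped \<delta> x = \<delta> * \<bar>u x\<bar>"
    using False assms by (cases "0 \<le> u x") (auto simp: clipped_def)
  ultimately show ?thesis
    by simp
qed

text \<open>The clipped value lies between 0 and \<open>u x\<close>, so its square is at most \<open>u x * clipped \<delta> x\<close>. Together
  with the previous lemma this makes the capped energy control both the mean shift and the variance.\<close>
lemma clipped_square_le:
  assumes "0 \<le> \<delta>"
  shows "(clipped \<delta> x)\<^sup>2 \<le> u x * clipped \<delta> x"
proof -
  have "0 \<le> (u x - clipped \<delta> x) * clipped \<delta> x"
    using assms by (auto simp: clipped_def min_def max_def zero_le_mult_iff)
  then show ?thesis
    by (simp add: algebra_simps power2_eq_square)
qed

lemma integrable_u_times:
  assumes "f \<in> borel_measurable R" "\<And>x. \<bar>f x\<bar> \<le> K"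
  shows "integrable R (\<lambda>x. u x * f x)"
proof (intro integrable_bounded[where K = K])
  fix x
  have "\<bar>u x\<bar> * \<bar>f x\<bar> \<le> 1 * K"
    using assms u_bound[of x] by (intro mult_mono) auto
  then show "\<bar>u x * f x\<bar> \<le> K"
    by (simp add: abs_mult)
qed (use assms in measurable)

lemma integral_tilt_split:
  assumes "f \<in> borel_measurable R" "\<And>x. \<bar>f x\<bar> \<le> K"
  shows "(\<integral>x. f x \<partial>tilt R u) = (\<integral>x. f x \<partial>R) + (\<integral>x. u x * f x \<partial>R)"
  using integrable_bounded[OF assms] integrable_u_times[OF assms] assms(1)
  by (simp add: integral_tilt distrib_right)

text \<open>What the exchange of one coordinate from \<open>Q\<close> to \<open>P\<close> gains, when \<open>s\<close> is the contribution of
  the other coordinates. The difference is the integral of \<open>2 * u y * ramp ((s + clipped \<delta> y) / L)\<close>, and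
  as \<open>u\<close> is centered, \<open>ramp (s / L)\<close> may be subtracted. The ramp is monotone and \<open>clipped \<delta>\<close> has
  the sign of \<open>u\<close>, so the integrand is never negative: an exchange never loses, whatever \<open>s\<close> is.
  If \<open>\<bar>s\<bar> \<le> L - \<delta>\<close>, no value \<open>s + clipped \<delta> y\<close> leaves the linear part of the ramp, and the integrand equals
  \<open>2 * u y * clipped \<delta> y / L\<close>.\<close>
lemma ramp_gain:
  assumes \<delta>: "0 < \<delta>" and L: "0 < L"
  shows "2 * capped_energy R \<delta> u / L * (if \<bar>s\<bar> \<le> L - \<delta> then 1 else 0)
    \<le> (\<integral>y. ramp ((s + clipped \<delta> y) / L) \<partial>tilt R u)
      - (\<integral>y. ramp ((s + clipped \<delta> y) / L) \<partial>tilt R (\<lambda>x. - u x))"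
proof -
  interpret neg: symmetric_tilt R "\<lambda>x. - u x"
    by (rule symmetric_tilt_minus)
  let ?h = "\<lambda>y. ramp ((s + clipped \<delta> y) / L)"
  let ?c = "(if \<bar>s\<bar> \<le> L - \<delta> then 1 else 0) :: real"
  have h: "?h \<in> borel_measurable R" "\<And>y. \<bar>?h y\<bar> \<le> 1"
    using ramp_bound by auto
  have "2 * capped_energy R \<delta> u / L * ?c = (\<integral>y. 2 * (u y * clipped \<delta> y) / L * ?c \<partial>R)"
    using \<delta> by (simp add: capped_energy_def u_times_clipped)
  also have "\<dots> \<le> (\<integral>y. 2 * (u y * (?h y - ramp (s / L))) \<partial>R)"
  proof (intro integral_mono)
    show "integrable R (\<lambda>y. 2 * (u y * clipped \<delta> y) / L * ?c)"
      using integrable_u_times[of "clipped \<delta>" \<delta>] clipped_bound \<delta> by auto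
    show "integrable R (\<lambda>y. 2 * (u y * (?h y - ramp (s / L))))"
      using integrable_u_times[OF h] integrable_u by (auto simp: right_diff_distrib)
    fix y
    have gain: "0 \<le> u y * (?h y - ramp (s / L))"
    proof (cases "0 \<le> u y")
      case True
      then have "ramp (s / L) \<le> ?h y"
        using \<delta> L by (intro ramp_mono divide_right_mono) (auto simp: clipped_def)
      then show ?thesis
        using True by simp
    next
      case False
      then have "?h y \<le> ramp (s / L)"
        using \<delta> L by (intro ramp_mono divide_right_mono) (auto simp: clipped_def)
      then show ?thesis
        using False by (simp add: mult_nonpos_nonpos)
    qed
    show "2 * (u y * clipped \<delta> y) / L * ?c \<le> 2 * (u y * (?h y - ramp (s / L)))"
    proof (cases "\<bar>s\<bar> \<le> L - \<delta>")
      case True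
      then have "\<bar>s + clipped \<delta> y\<bar> \<le> L" "\<bar>s\<bar> \<le> L"
        using clipped_bound[of \<delta> y] \<delta> by linarith+
      then have "\<bar>(s + clipped \<delta> y) / L\<bar> \<le> 1" "\<bar>s / L\<bar> \<le> 1"
        using L by (simp_all add: abs_divide)
      then have "?h y - ramp (s / L) = clipped \<delta> y / L"
        by (simp add: ramp_eq add_divide_distrib)
      then show ?thesis
        using True by simp
    qed (use gain in simp)
  qed
  also have "\<dots> = 2 * (\<integral>y. u y * ?h y \<partial>R)"
    using integrable_u_times[OF h] integrable_u u_centered by (simp add: right_diff_distrib)
  also have "\<dots> = (\<integral>y. ?h y \<partial>tilt R u) - (\<integral>y. ?h y \<partial>tilt R (\<lambda>x. - u x))"
    using integral_tilt_split[OF h] neg.integral_tilt_split[OF h] by simp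
  finally show ?thesis .
qed

lemma clipped_mean_tilt:
  assumes "0 \<le> \<delta>"
  shows "(\<integral>x. clipped \<delta> x \<partial>tilt R u) = (\<integral>x. clipped \<delta> x \<partial>R) + capped_energy R \<delta> u"
  using integral_tilt_split[of "clipped \<delta>" \<delta>] clipped_bound[OF assms]
  by (simp add: capped_energy_def u_times_clipped assms)

lemma clipped_variance_tilt:
  assumes \<delta>: "0 \<le> \<delta>"
  shows "(\<integral>x. (clipped \<delta> x - (\<integral>y. clipped \<delta> y \<partial>tilt R u))\<^sup>2 \<partial>tilt R u) \<le> 2 * capped_energy R \<delta> u"
proof -
  interpret P: prob_space "tilt R u"
    by (rule prob_space_tilt)
  have sq: "(clipped \<delta> x)\<^sup>2 \<le> \<delta>\<^sup>2" for x
    using clipped_bound[OF \<delta>, of x] by (metis abs_ge_zero power2_abs power_mono)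
  have int: "integrable (tilt R u) (clipped \<delta>)" "integrable (tilt R u) (\<lambda>x. (clipped \<delta> x)\<^sup>2)"
  proof -
    show "integrable (tilt R u) (clipped \<delta>)"
      using clipped_bound[OF \<delta>] by (intro P.integrable_const_bound[where B = \<delta>]) auto
    show "integrable (tilt R u) (\<lambda>x. (clipped \<delta> x)\<^sup>2)"
      using sq by (intro P.integrable_const_bound[where B = "\<delta>\<^sup>2"]) auto
  qed
  have intR: "integrable R (\<lambda>x. (clipped \<delta> x)\<^sup>2)" "integrable R (\<lambda>x. u x * (clipped \<delta> x)\<^sup>2)"
    using sq by (auto intro!: integrable_bounded[where K = "\<delta>\<^sup>2"] integrable_u_times[where K = "\<delta>\<^sup>2"])
  have "(\<integral>x. (clipped \<delta> x - (\<integral>y. clipped \<delta> y \<partial>tilt R u))\<^sup>2 \<partial>tilt R u) \<le> (\<integral>x. (clipped \<delta> x)\<^sup>2 \<partial>tilt R u)"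
    using P.variance_eq[OF int] by simp
  also have "\<dots> = (\<integral>x. (1 + u x) * (clipped \<delta> x)\<^sup>2 \<partial>R)"
    by (simp add: integral_tilt)
  also have "\<dots> \<le> (\<integral>x. 2 * min ((u x)\<^sup>2) (\<delta> * \<bar>u x\<bar>) \<partial>R)"
  proof (intro integral_mono)
    show "integrable R (\<lambda>x. (1 + u x) * (clipped \<delta> x)\<^sup>2)"
      using intR by (simp add: distrib_right)
    show "integrable R (\<lambda>x. 2 * min ((u x)\<^sup>2) (\<delta> * \<bar>u x\<bar>))"
      using integrable_capped[OF \<delta>] by simp
    fix x
    have "(1 + u x) * (clipped \<delta> x)\<^sup>2 \<le> 2 * (clipped \<delta> x)\<^sup>2"
      using u_bound[of x] by (intro mult_right_mono) auto
    also have "\<dots> \<le> 2 * min ((u x)\<^sup>2) (\<delta> * \<bar>u x\<bar>)"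
      using clipped_square_le[OF \<delta>, of x] u_times_clipped[OF \<delta>, of x] by simp
    finally show "(1 + u x) * (clipped \<delta> x)\<^sup>2 \<le> 2 * min ((u x)\<^sup>2) (\<delta> * \<bar>u x\<bar>)" .
  qed
  finally show ?thesis
    by (simp add: capped_energy_def)
qed

text \<open>These distributions interpolate between the power of \<open>Q\<close>, at \<open>k = 0\<close>, and that of \<open>P\<close>, at \<open>k = n\<close>;
  consecutive ones differ in the coordinate \<open>k\<close> only.\<close>
definition hybrid :: "nat \<Rightarrow> nat \<Rightarrow> 'a measure" where
  "hybrid k i = (if i < k then tilt R u else tilt R (\<lambda>x. - u x))"

lemma sets_hybrid [simp, measurable_cong]: "sets (hybrid k i) = sets R"
  by (simp add: hybrid_def)

lemma prob_space_hybrid: "prob_space (hybrid k i)"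
  using prob_space_tilt symmetric_tilt.prob_space_tilt[OF symmetric_tilt_minus]
  by (simp add: hybrid_def)

text \<open>Each coordinate mean of \<open>clipped \<delta>\<close> is within the capped energy of the mean under \<open>R\<close>, so the
  sum \<open>S\<close> drifts by at most \<open>N\<close>; a further \<open>\<delta>\<close> accounts for the coordinate that is being exchanged and
  is absent from \<open>I\<close>. The variance of the sum is at most \<open>2 * N\<close>, and Chebyshev's inequality at two
  standard deviations gives the probability \<open>3 / 4\<close>.\<close>
lemma hybrid_concentration:
  fixes I :: "nat set"
  assumes \<delta>: "0 < \<delta>" and I: "finite I" "card I + 1 = n"
    and V: "0 < capped_energy R \<delta> u"
  defines "N \<equiv> real n * capped_energy R \<delta> u"
  defines "S \<equiv> \<lambda>x. (\<Sum>i\<in>I. clipped \<delta> (x i)) - real n * (\<integral>y. clipped \<delta> y \<partial>R)"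
  shows "3 / 4 \<le> measure (PiM I (hybrid k))
    {x \<in> space (PiM I (hybrid k)). \<bar>S x\<bar> \<le> N + \<delta> + 2 * sqrt (2 * N)}"
proof -
  interpret neg: symmetric_tilt R "\<lambda>x. - u x"
    by (rule symmetric_tilt_minus)
  let ?V = "capped_energy R \<delta> u"
  let ?H = "PiM I (hybrid k)"
  define \<mu> where "\<mu> = (\<integral>y. clipped \<delta> y \<partial>R)"
  define e where "e i = (\<integral>y. clipped \<delta> y \<partial>hybrid k i)" for i
  define W where "W x = (\<Sum>i\<in>I. clipped \<delta> (x i) - e i)" for x
  interpret H: prob_space ?H
    using prob_space_hybrid by (intro prob_space_PiM)
  have \<delta>0: "0 \<le> \<delta>"
    using \<delta> by simp
  have V_neg: "capped_energy R \<delta> (\<lambda>x. - u x) = ?V"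
    by (simp add: capped_energy_def)
  have clipped_neg: "neg.clipped \<delta> = (\<lambda>x. - clipped \<delta> x)"
    using \<delta> by (auto simp: fun_eq_iff neg.clipped_def clipped_def)
  have mean_neg: "(\<integral>x. clipped \<delta> x \<partial>tilt R (\<lambda>x. - u x)) = \<mu> - ?V"
    using neg.clipped_mean_tilt[OF \<delta>0] by (simp add: clipped_neg V_neg \<mu>_def)
  have e_mean: "\<bar>e i - \<mu>\<bar> \<le> ?V" for i
    using clipped_mean_tilt[OF \<delta>0] mean_neg V by (simp add: e_def hybrid_def \<mu>_def)
  have e_bound: "\<bar>e i\<bar> \<le> \<delta>" for i
  proof -
    interpret Hi: prob_space "hybrid k i"
      by (rule prob_space_hybrid)
    have "\<bar>e i\<bar> \<le> (\<integral>y. \<bar>clipped \<delta> y\<bar> \<partial>hybrid k i)"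
      unfolding e_def by (rule integral_abs_bound)
    also have "\<dots> \<le> \<delta>"
      using clipped_bound[OF \<delta>0]
      by (intro Hi.integral_le_const Hi.integrable_const_bound[where B = \<delta>]) auto
    finally show ?thesis .
  qed
  have \<mu>_bound: "\<bar>\<mu>\<bar> \<le> \<delta>"
  proof -
    have "\<bar>\<mu>\<bar> \<le> (\<integral>y. \<bar>clipped \<delta> y\<bar> \<partial>R)"
      unfolding \<mu>_def by (rule integral_abs_bound)
    also have "\<dots> \<le> \<delta>"
      using clipped_bound[OF \<delta>0]
      by (intro integral_le_const integrable_const_bound[where B = \<delta>]) auto
    finally show ?thesis .
  qed
  have var: "(\<integral>x. (clipped \<delta> x - e i)\<^sup>2 \<partial>hybrid k i) \<le> 2 * ?V" for i
    using clipped_variance_tilt[OF \<delta>0] neg.clipped_variance_tilt[OF \<delta>0]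
    by (simp add: e_def hybrid_def clipped_neg V_neg power2_commute)
  have centered: "(\<integral>x. clipped \<delta> x - e i \<partial>hybrid k i) = 0" for i
  proof -
    interpret Hi: prob_space "hybrid k i"
      by (rule prob_space_hybrid)
    have "integrable (hybrid k i) (clipped \<delta>)"
      using clipped_bound[OF \<delta>0] by (intro Hi.integrable_const_bound[where B = \<delta>]) auto
    then show ?thesis
      by (simp add: e_def Hi.prob_space)
  qed
  have bound: "\<bar>clipped \<delta> x - e i\<bar> \<le> 2 * \<delta>" for i x
    using clipped_bound[OF \<delta>0, of x] e_bound[of i] by linarith
  have meas: "(\<lambda>x. clipped \<delta> x - e i) \<in> borel_measurable (hybrid k i)" for i
    by measurable
  note W2 = second_moment_sum_le[where M = "hybrid k" and g = "\<lambda>i x. clipped \<delta> x - e i",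
      OF prob_space_hybrid I(1) meas bound centered var, folded W_def]
  have W_meas [measurable]: "W \<in> borel_measurable ?H"
    unfolding W_def by measurable
  have N0: "0 < N"
    using V I by (auto simp: N_def)
  have drift: "\<bar>S x - W x\<bar> \<le> N + \<delta>" for x
  proof -
    have "S x - W x = (\<Sum>i\<in>I. e i - \<mu>) - \<mu>"
      using I by (auto simp: S_def W_def sum_subtractf \<mu>_def algebra_simps)
    moreover have "\<bar>\<Sum>i\<in>I. e i - \<mu>\<bar> \<le> real (card I) * ?V"
      using sum_norm_bound[of I "\<lambda>i. e i - \<mu>" ?V] e_mean by simp
    moreover have "real (card I) * ?V \<le> N"
      unfolding N_def using I V by (intro mult_right_mono) auto
    ultimately show ?thesis
      using \<mu>_bound by linarith
  qed
  have "measure ?H {x \<in> space ?H. 2 * sqrt (2 * N) \<le> \<bar>W x\<bar>} \<le> (\<integral>x. (W x)\<^sup>2 \<partial>?H) / (2 * sqrt (2 * N))\<^sup>2"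
    using W2(2) N0 by (intro H.second_moment_method) auto
  also have "\<dots> \<le> 2 * N / (2 * sqrt (2 * N))\<^sup>2"
  proof (intro divide_right_mono)
    have "real (card I) * (2 * ?V) \<le> 2 * N"
      unfolding N_def using I V by simp
    then show "(\<integral>x. (W x)\<^sup>2 \<partial>?H) \<le> 2 * N"
      using W2(1) by linarith
  qed simp
  also have "\<dots> = 1 / 4"
    using N0 by (simp add: power_mult_distrib)
  finally have tail: "measure ?H {x \<in> space ?H. 2 * sqrt (2 * N) \<le> \<bar>W x\<bar>} \<le> 1 / 4" .
  have "3 / 4 \<le> measure ?H (space ?H - {x \<in> space ?H. 2 * sqrt (2 * N) \<le> \<bar>W x\<bar>})"
    using tail by (subst H.prob_compl) auto
  also have "\<dots> \<le> measure ?H {x \<in> space ?H. \<bar>S x\<bar> \<le> N + \<delta> + 2 * sqrt (2 * N)}"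
  proof (rule H.finite_measure_mono)
    show "space ?H - {x \<in> space ?H. 2 * sqrt (2 * N) \<le> \<bar>W x\<bar>}
      \<subseteq> {x \<in> space ?H. \<bar>S x\<bar> \<le> N + \<delta> + 2 * sqrt (2 * N)}"
    proof safe
      fix x assume "\<not> 2 * sqrt (2 * N) \<le> \<bar>W x\<bar>"
      then show "\<bar>S x\<bar> \<le> N + \<delta> + 2 * sqrt (2 * N)"
        using drift[of x] by linarith
    qed
    show "{x \<in> space ?H. \<bar>S x\<bar> \<le> N + \<delta> + 2 * sqrt (2 * N)} \<in> sets ?H"
      unfolding S_def by measurable
  qed
  finally show ?thesis .
qed

text \<open>The test function is the ramp of the centered sum of the clipped values, of width
  \<open>L = N + 2 * \<delta> + 2 * sqrt (2 * N)\<close>. This is the least width for which the concentration lemma keeps the sum of the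
  other coordinates within \<open>L - \<delta>\<close>. The \<open>n\<close> exchanges of a coordinate together gain at least
  \<open>2 * (3 / 4) * N / L\<close>, which bounds twice the total variation distance from below. Finally \<open>N \<ge> 200 * \<delta>\<^sup>2\<close>
  makes \<open>\<delta> * L \<le> (1 / 2 + 1 / 100 + 1 / 5) * N\<close>, which is less than \<open>3 / 4 * N\<close>.\<close>
lemma tv_large_if_many_samples:
  assumes \<delta>: "0 < \<delta>" "\<delta> \<le> 1 / 2" and n: "200 * \<delta>\<^sup>2 \<le> real n * capped_energy R \<delta> u"
  shows "\<delta> \<le> tv_dist (product_power (tilt R u) n) (product_power (tilt R (\<lambda>x. - u x)) n)"
proof -
  let ?V = "capped_energy R \<delta> u"
  define N where "N = real n * ?V"
  define L where "L = N + 2 * \<delta> + 2 * sqrt (2 * N)"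
  define \<mu> where "\<mu> = (\<integral>y. clipped \<delta> y \<partial>R)"
  define f where "f x = ramp (((\<Sum>i<n. clipped \<delta> (x i)) - real n * \<mu>) / L)" for x :: "nat \<Rightarrow> 'a"
  have N: "200 * \<delta>\<^sup>2 \<le> N"
    using n by (simp add: N_def)
  moreover have "0 < 200 * \<delta>\<^sup>2"
    using \<delta> by simp
  ultimately have N0: "0 < N"
    by linarith
  have V0: "0 \<le> ?V"
    using \<delta> by (intro capped_energy_nonneg) simp
  with N0 have V: "0 < ?V" and n0: "0 < n"
    by (auto simp: N_def zero_less_mult_iff)
  have L: "0 < L"
    using N0 \<delta> by (simp add: L_def add_pos_nonneg)
  have f_bound: "\<bar>f x\<bar> \<le> 1" for x
    by (simp add: f_def ramp_bound)
  have step: "2 * ?V / L * (3 / 4)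
    \<le> (\<integral>x. f x \<partial>PiM {..<n} (hybrid (Suc k))) - (\<integral>x. f x \<partial>PiM {..<n} (hybrid k))"
    if k: "k < n" for k
  proof -
    define I where "I = {..<n} - {k}"
    have I: "finite I" "k \<notin> I" "insert k I = {..<n}" "card I + 1 = n"
      using k by (auto simp: I_def)
    let ?H = "PiM I (hybrid (Suc k))"
    interpret H: prob_space ?H
      using prob_space_hybrid by (intro prob_space_PiM)
    define S where "S x = (\<Sum>i\<in>I. clipped \<delta> (x i)) - real n * \<mu>" for x
    define G where "G = {x \<in> space ?H. \<bar>S x\<bar> \<le> L - \<delta>}"
    have G [measurable]: "G \<in> sets ?H"
      unfolding G_def S_def by measurable
    have LN: "L - \<delta> = N + \<delta> + 2 * sqrt (2 * N)"
      by (simp add: L_def)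
    have prob_G: "3 / 4 \<le> measure ?H G"
      using hybrid_concentration[OF \<delta>(1) I(1,4) V, of "Suc k"]
      unfolding G_def S_def LN \<mu>_def N_def .
    have f_upd: "f (x(k := y)) = ramp ((S x + clipped \<delta> y) / L)" for x y
    proof -
      have "(\<Sum>i\<in>I. clipped \<delta> ((x(k := y)) i)) = (\<Sum>i\<in>I. clipped \<delta> (x i))"
        using I by (intro sum.cong) auto
      then have "(\<Sum>i<n. clipped \<delta> ((x(k := y)) i)) = clipped \<delta> y + (\<Sum>i\<in>I. clipped \<delta> (x i))"
        unfolding I(3)[symmetric] using I(1,2) by simp
      then show ?thesis
        by (simp add: f_def S_def algebra_simps)
    qed
    let ?D = "\<lambda>x. (\<integral>y. f (x(k := y)) \<partial>hybrid (Suc k) k) - (\<integral>y. f (x(k := y)) \<partial>hybrid k k)"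
    have f_meas: "f \<in> borel_measurable (PiM (insert k I) (hybrid (Suc k)))"
      unfolding f_def I(3) by measurable
    have off_k: "hybrid (Suc k) i = hybrid k i" if "i \<in> I" for i
      using that I by (auto simp: hybrid_def less_Suc_eq)
    have sets_k: "sets (hybrid (Suc k) k) = sets (hybrid k k)"
      by simp
    note change = integral_change_coordinate[OF prob_space_hybrid prob_space_hybrid off_k sets_k
        I(1,2) f_meas f_bound]
    have "2 * ?V / L * (3 / 4) \<le> 2 * ?V / L * measure ?H G"
      using prob_G V L by (intro mult_left_mono) auto
    also have "\<dots> = (\<integral>x. 2 * ?V / L * indicator G x \<partial>?H)"
      using G by (simp add: Int_absorb2 sets.sets_into_space)
    also have "\<dots> \<le> (\<integral>x. ?D x \<partial>?H)"
    proof (intro integral_mono)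
      show "integrable ?H ?D"
        by (rule change(2))
      show "integrable ?H (\<lambda>x. 2 * ?V / L * indicator G x)"
        using G by (intro integrable_mult_right integrable_real_indicator) (auto simp: less_top[symmetric])
      fix x assume "x \<in> space ?H"
      then have "indicator G x = (if \<bar>S x\<bar> \<le> L - \<delta> then 1 else 0 :: real)"
        by (simp add: G_def)
      then show "2 * ?V / L * indicator G x \<le> ?D x"
        using ramp_gain[OF \<delta>(1) L, of "S x"] by (simp add: f_upd hybrid_def)
    qed
    also have "\<dots> = (\<integral>x. f x \<partial>PiM {..<n} (hybrid (Suc k))) - (\<integral>x. f x \<partial>PiM {..<n} (hybrid k))"
      using change(1) by (simp only: I(3))
    finally show ?thesis .
  qed
  have "real n * (2 * ?V / L * (3 / 4)) = (\<Sum>k<n. 2 * ?V / L * (3 / 4))"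
    by simp
  also have "\<dots> \<le> (\<Sum>k<n. (\<integral>x. f x \<partial>PiM {..<n} (hybrid (Suc k))) - (\<integral>x. f x \<partial>PiM {..<n} (hybrid k)))"
    by (rule sum_mono) (use step in simp)
  also have "\<dots> = (\<integral>x. f x \<partial>PiM {..<n} (hybrid n)) - (\<integral>x. f x \<partial>PiM {..<n} (hybrid 0))"
    by (rule sum_lessThan_telescope)
  also have "PiM {..<n} (hybrid n) = product_power (tilt R u) n"
    by (intro PiM_cong) (auto simp: hybrid_def)
  also have "PiM {..<n} (hybrid 0) = product_power (tilt R (\<lambda>x. - u x)) n"
    by (intro PiM_cong) (auto simp: hybrid_def)
  also have "(\<integral>x. f x \<partial>product_power (tilt R u) n) - (\<integral>x. f x \<partial>product_power (tilt R (\<lambda>x. - u x)) n)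
    \<le> 2 * tv_dist (product_power (tilt R u) n) (product_power (tilt R (\<lambda>x. - u x)) n)"
  proof (rule integral_diff_le_tv_dist)
    show "f \<in> borel_measurable (product_power R n)"
      unfolding f_def by measurable
  qed (rule f_bound)
  finally have tv: "3 / 4 * N / L
    \<le> tv_dist (product_power (tilt R u) n) (product_power (tilt R (\<lambda>x. - u x)) n)"
    by (simp add: N_def)
  have "\<delta> * L \<le> 3 / 4 * N"
  proof -
    define r where "r = sqrt (2 * N)"
    have r: "r\<^sup>2 = 2 * N"
      using N0 by (simp add: r_def)
    have "(20 * \<delta>)\<^sup>2 \<le> r\<^sup>2"
      unfolding r using N by (simp add: power_mult_distrib)
    then have "20 * \<delta> \<le> r"
      by (rule power2_le_imp_le) (use N0 in \<open>simp add: r_def\<close>)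
    then have "20 * \<delta> * r \<le> r * r"
      using N0 by (intro mult_right_mono) (auto simp: r_def)
    then have "20 * (\<delta> * r) \<le> 2 * N"
      unfolding r[symmetric] by (simp add: power2_eq_square)
    moreover have "\<delta> * N \<le> 1 / 2 * N"
      using \<delta> N0 by (intro mult_right_mono) auto
    moreover have "\<delta> * L = \<delta> * N + 2 * \<delta>\<^sup>2 + 2 * (\<delta> * r)"
      by (simp add: L_def r_def algebra_simps power2_eq_square)
    ultimately show ?thesis
      using N N0 by linarith
  qed
  then have "\<delta> \<le> 3 / 4 * N / L"
    using L by (simp add: pos_le_divide_eq)
  then show ?thesis
    using tv by linarith
qed

end

section \<open>The sample complexity\<close>

context symmetric_tilt
begin

lemma tilt_eq_if_no_energy:
  assumes \<delta>: "0 < \<delta>" and V: "capped_energy R \<delta> u = 0"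
  shows "tilt R u = tilt R (\<lambda>x. - u x)"
proof -
  have "AE x in R. min ((u x)\<^sup>2) (\<delta> * \<bar>u x\<bar>) = 0"
    using V integrable_capped[of \<delta>] \<delta> unfolding capped_energy_def
    by (subst (asm) integral_nonneg_eq_0_iff_AE) auto
  then have "AE x in R. ennreal (1 + u x) = ennreal (1 + - u x)"
    by eventually_elim (use \<delta> in \<open>auto simp: min_def split: if_splits\<close>)
  then show ?thesis
    unfolding tilt_def by (intro density_cong) auto
qed

lemma sample_complexity_bounds:
  fixes \<delta> :: real
  assumes \<delta>: "0 < \<delta>" "\<delta> \<le> 1 / 2" and V: "0 < capped_energy R \<delta> u"
  defines "P \<equiv> tilt R u" and "Q \<equiv> tilt R (\<lambda>x. - u x)"
    and "B \<equiv> max 1 (\<delta>\<^sup>2 / capped_energy R \<delta> u)"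
  shows "\<exists>n. enough_samples \<delta> P Q n"
    and "1 / 100 * B \<le> real (sample_complexity \<delta> P Q)"
    and "real (sample_complexity \<delta> P Q) \<le> 201 * B"
proof -
  let ?V = "capped_energy R \<delta> u"
  define n where "n = nat \<lceil>200 * \<delta>\<^sup>2 / ?V\<rceil>"
  have ratio: "0 < 200 * \<delta>\<^sup>2 / ?V"
    using \<delta> V by simp
  then have n1: "1 \<le> n"
    unfolding n_def by linarith
  have "200 * \<delta>\<^sup>2 / ?V \<le> real n"
    unfolding n_def by linarith
  then have "200 * \<delta>\<^sup>2 \<le> real n * ?V"
    using V by (simp add: pos_divide_le_eq)
  then have n: "enough_samples \<delta> P Q n"
    using tv_large_if_many_samples[OF \<delta>] n1 by (simp add: enough_samples_def P_def Q_def)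
  then show "\<exists>n. enough_samples \<delta> P Q n"
    by blast
  have "real n \<le> 200 * \<delta>\<^sup>2 / ?V + 1"
    using ratio unfolding n_def by linarith
  also have "\<dots> \<le> 201 * B"
    by (simp add: B_def max_def)
  finally have "real n \<le> 201 * B" .
  moreover have "sample_complexity \<delta> P Q \<le> n"
    unfolding sample_complexity_def using n by (rule Least_le)
  ultimately show "real (sample_complexity \<delta> P Q) \<le> 201 * B"
    by linarith
  let ?N = "sample_complexity \<delta> P Q"
  have N: "enough_samples \<delta> P Q ?N"
    unfolding sample_complexity_def using n by (rule LeastI)
  have "\<not> real ?N * ?V \<le> \<delta>\<^sup>2 / 100"
    using tv_small_if_few_samples[OF \<delta>, of ?N] N \<delta>
    by (auto simp: enough_samples_def P_def Q_def)
  then have "\<delta>\<^sup>2 / ?V \<le> 100 * real ?N"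
    using V by (simp add: pos_divide_le_eq mult_ac)
  moreover have "1 \<le> real ?N"
    using N by (simp add: enough_samples_def)
  ultimately show "1 / 100 * B \<le> real ?N"
    by (simp add: B_def)
qed

end

lemma ennreal_half: "(1 / 2 :: ennreal) = ennreal (1 / 2)"
  using divide_ennreal[of 1 2] by (simp only: ennreal_1 ennreal_numeral zero_le_one zero_less_numeral)

lemma scale_measure_add_eq_density:
  assumes "sets P = sets Q"
  shows "scale_measure (1 / 2) (measure_add P Q) = density (measure_add P Q) (\<lambda>_. ennreal (1 / 2))"
proof (rule measure_eqI)
  fix B assume "B \<in> sets (scale_measure (1 / 2) (measure_add P Q))"
  then show "emeasure (scale_measure (1 / 2) (measure_add P Q)) B
    = emeasure (density (measure_add P Q) (\<lambda>_. ennreal (1 / 2))) B"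
    unfolding ennreal_half by (simp add: emeasure_density nn_integral_cmult_indicator)
qed simp

text \<open>Testing the hypothesis on the set where \<open>g\<close> is negative shows that this set is null.\<close>
lemma AE_nonneg_if_set_integrals_nonneg:
  fixes g :: "'a \<Rightarrow> real"
  assumes g: "integrable M g" and pos: "\<And>B. B \<in> sets M \<Longrightarrow> 0 \<le> (\<integral>x. g x * indicator B x \<partial>M)"
  shows "AE x in M. 0 \<le> g x"
proof -
  define B where "B = {x \<in> space M. g x < 0}"
  have B: "B \<in> sets M"
    using g unfolding B_def by measurable
  have int: "integrable M (\<lambda>x. - (g x * indicator B x))"
    using g B by (intro integrable_minus integrable_real_mult_indicator)
  have nonneg: "AE x in M. 0 \<le> - (g x * indicator B x)"
    by (auto simp: B_def indicator_def)
  have "(\<integral>x. - (g x * indicator B x) \<partial>M) = 0"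
    using pos[OF B] integral_nonneg_AE[OF nonneg] by simp
  then have "AE x in M. - (g x * indicator B x) = 0"
    using integral_nonneg_eq_0_iff_AE[OF int nonneg] by simp
  then show ?thesis
    by (rule AE_mp) (auto intro!: AE_I2 simp: B_def indicator_def split: if_splits)
qed

lemma eq_tilt:
  assumes P: "prob_space P" and sets: "sets P = sets R" and R: "symmetric_tilt R w"
    and B: "\<And>B. B \<in> sets R \<Longrightarrow> measure P B = (\<integral>x. (1 + w x) * indicator B x \<partial>R)"
  shows "P = tilt R w"
proof (rule measure_eqI)
  interpret P: prob_space P by fact
  interpret R: symmetric_tilt R w by fact
  interpret T: prob_space "tilt R w" by (rule R.prob_space_tilt)
  fix A assume "A \<in> sets P"
  then have A: "A \<in> sets R"
    by (simp add: sets)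
  then have "measure (tilt R w) A = (\<integral>x. indicator A x \<partial>tilt R w)"
    by (simp add: Int_absorb2 sets.sets_into_space)
  also have "\<dots> = measure P A"
    using A B by (subst R.integral_tilt) auto
  finally show "emeasure P A = emeasure (tilt R w) A"
    by (simp add: P.emeasure_eq_measure T.emeasure_eq_measure)
qed (simp add: sets)

text \<open>From \<open>P + Q = 2 R\<close> and \<open>P - Q = 2 u R\<close> it follows that \<open>P = (1 + u) R\<close> and \<open>Q = (1 - u) R\<close>. Both are
  nonnegative, so \<open>\<bar>u\<bar> \<le> 1\<close> almost everywhere; clipping \<open>u\<close> at \<open>\<plusminus>1\<close> makes this hold
  everywhere and changes \<open>u\<close> on a null set only.\<close>
lemma tilt_representation:
  assumes P: "prob_space P" and Q: "prob_space Q" and sets: "sets P = sets Q"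
    and u: "RN_deriv_diff (measure_add P Q) P Q u"
  defines "R \<equiv> scale_measure (1 / 2) (measure_add P Q)" and "w \<equiv> \<lambda>x. max (- 1) (min 1 (u x))"
  shows "symmetric_tilt R w" and "P = tilt R w" and "Q = tilt R (\<lambda>x. - w x)"
    and "AE x in R. w x = u x"
proof -
  interpret P: prob_space P by fact
  interpret Q: prob_space Q by fact
  have R: "R = density (measure_add P Q) (\<lambda>_. ennreal (1 / 2))"
    unfolding R_def by (rule scale_measure_add_eq_density[OF sets])
  have sets_R: "sets R = sets P" "space R = space P"
    by (simp_all add: R)
  have emeasure_R: "emeasure R B = ennreal ((measure P B + measure Q B) / 2)" if "B \<in> sets P" for B
  proof -
    have "emeasure R B = ennreal (1 / 2) * (ennreal (measure P B) + ennreal (measure Q B))"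
      using emeasure_measure_add[OF sets that] unfolding R_def ennreal_half
      by (simp only: emeasure_scale_measure P.emeasure_eq_measure Q.emeasure_eq_measure)
    also have "\<dots> = ennreal (1 / 2 * (measure P B + measure Q B))"
      using ennreal_plus[OF measure_nonneg measure_nonneg, of P B Q B] by (subst ennreal_mult) auto
    finally show ?thesis
      by simp
  qed
  interpret R: prob_space R
  proof
    show "emeasure R (space R) = 1"
      using emeasure_R[OF sets.top] P.prob_space Q.prob_space sets_eq_imp_space_eq[OF sets]
      by (simp add: sets_R)
  qed
  have u_M: "integrable (measure_add P Q) u"
    using u by (simp add: RN_deriv_diff_def)
  then have [measurable]: "u \<in> borel_measurable R"
    by (simp add: R borel_measurable_integrable)
  have int_u: "integrable R u"
    unfolding R using u_M by (subst integrable_real_density) auto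
  have sum_PQ: "measure P B + measure Q B = 2 * measure R B" if "B \<in> sets R" for B
    using emeasure_R[of B] that by (simp add: sets_R measure_def)
  have diff_PQ: "measure P B - measure Q B = 2 * (\<integral>x. u x * indicator B x \<partial>R)" if B: "B \<in> sets R" for B
  proof -
    have "(\<integral>x. u x * indicator B x \<partial>R) = (\<integral>x. 1 / 2 * (u x * indicator B x) \<partial>measure_add P Q)"
      unfolding R using B u_M by (subst integral_real_density) (auto simp: sets_R)
    then show ?thesis
      using u B by (simp add: RN_deriv_diff_def sets_R set_lebesgue_integral_def mult.commute)
  qed
  have int_ind: "integrable R (\<lambda>x. u x * indicator B x)" "integrable R (indicator B :: 'a \<Rightarrow> real)"
    if "B \<in> sets R" for B
    using int_u that by (auto intro!: integrable_real_mult_indicator simp: less_top[symmetric])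
  have PB: "measure P B = (\<integral>x. (1 + u x) * indicator B x \<partial>R)"
    and QB: "measure Q B = (\<integral>x. (1 - u x) * indicator B x \<partial>R)" if B: "B \<in> sets R" for B
  proof -
    have "(\<integral>x. (1 + u x) * indicator B x \<partial>R) = measure R B + (\<integral>x. u x * indicator B x \<partial>R)"
      "(\<integral>x. (1 - u x) * indicator B x \<partial>R) = measure R B - (\<integral>x. u x * indicator B x \<partial>R)"
      using int_ind[OF B] B
      by (simp_all add: distrib_right left_diff_distrib Int_absorb2 sets.sets_into_space)
    then show "measure P B = (\<integral>x. (1 + u x) * indicator B x \<partial>R)"
      "measure Q B = (\<integral>x. (1 - u x) * indicator B x \<partial>R)"
      using sum_PQ[OF B] diff_PQ[OF B] by simp_all
  qed
  have "AE x in R. 0 \<le> 1 + u x" "AE x in R. 0 \<le> 1 - u x"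
    using int_u by (intro AE_nonneg_if_set_integrals_nonneg; simp flip: PB QB)+
  then show AE_eq: "AE x in R. w x = u x"
    by eventually_elim (auto simp: w_def)
  have [measurable]: "w \<in> borel_measurable R"
    unfolding w_def by measurable
  have "(\<integral>x. w x \<partial>R) = (\<integral>x. u x \<partial>R)"
    using AE_eq by (intro integral_cong_AE) auto
  also have "\<dots> = (\<integral>x. u x * indicator (space R) x \<partial>R)"
    by (intro Bochner_Integration.integral_cong) auto
  also have "\<dots> = 0"
    using diff_PQ[OF sets.top] P.prob_space Q.prob_space sets_eq_imp_space_eq[OF sets]
    by (simp add: sets_R)
  finally have "(\<integral>x. w x \<partial>R) = 0" .
  then show tilt: "symmetric_tilt R w"
    by unfold_locales (auto simp: w_def)
  show "P = tilt R w"
  proof (rule eq_tilt[OF P sets_R(1)[symmetric] tilt])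
    fix B assume B: "B \<in> sets R"
    show "measure P B = (\<integral>x. (1 + w x) * indicator B x \<partial>R)"
      unfolding PB[OF B] using AE_eq B by (intro integral_cong_AE) auto
  qed
  show "Q = tilt R (\<lambda>x. - w x)"
  proof (rule eq_tilt[OF Q _ symmetric_tilt.symmetric_tilt_minus[OF tilt]])
    fix B assume B: "B \<in> sets R"
    show "measure Q B = (\<integral>x. (1 + - w x) * indicator B x \<partial>R)"
      unfolding QB[OF B] using AE_eq B by (intro integral_cong_AE) auto
  qed (simp add: sets_R sets)
qed

theorem corollary3p3:
  "\<exists>c\<in>universal_range. \<exists>C\<in>universal_range. 0 < c \<and> c \<le> C \<and>
    (\<forall>(P :: 'a measure) (Q :: 'a measure) (\<delta> :: real) (u :: 'a \<Rightarrow> real)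
       (\<Omega> :: 'b measure) (X :: 'b \<Rightarrow> 'a).
      prob_space P \<longrightarrow> prob_space Q \<longrightarrow> sets P = sets Q \<longrightarrow> P \<noteq> Q \<longrightarrow>
      0 < \<delta> \<longrightarrow> \<delta> \<le> 1 / 2 \<longrightarrow>
      RN_deriv_diff (measure_add P Q) P Q u \<longrightarrow>
      prob_space \<Omega> \<longrightarrow> X \<in> measurable \<Omega> P \<longrightarrow>
      distr \<Omega> P X = scale_measure (1 / 2) (measure_add P Q) \<longrightarrow>
      (let U = (\<lambda>\<omega>. u (X \<omega>));
           B = max 1 (\<delta>\<^sup>2 / prob_space.expectation \<Omega> (\<lambda>\<omega>. min ((U \<omega>)\<^sup>2) (\<delta> * \<bar>U \<omega>\<bar>)))
       in (\<exists>n. enough_samples \<delta> P Q n) \<and>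
          c * B \<le> real (sample_complexity \<delta> P Q) \<and>
          real (sample_complexity \<delta> P Q) \<le> C * B))"
proof -
  have bounds: "let U = (\<lambda>\<omega>. u (X \<omega>));
           B = max 1 (\<delta>\<^sup>2 / prob_space.expectation \<Omega> (\<lambda>\<omega>. min ((U \<omega>)\<^sup>2) (\<delta> * \<bar>U \<omega>\<bar>)))
       in (\<exists>n. enough_samples \<delta> P Q n) \<and>
          1 / 100 * B \<le> real (sample_complexity \<delta> P Q) \<and>
          real (sample_complexity \<delta> P Q) \<le> 201 * B"
    if P: "prob_space P" and Q: "prob_space Q" and sets: "sets P = sets Q" and neq: "P \<noteq> Q"
      and \<delta>: "0 < \<delta>" "\<delta> \<le> 1 / 2" and u: "RN_deriv_diff (measure_add P Q) P Q u"
      and X [measurable]: "X \<in> measurable \<Omega> P"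
      and distr: "distr \<Omega> P X = scale_measure (1 / 2) (measure_add P Q)"
    for P Q :: "'a measure" and \<delta> :: real and u :: "'a \<Rightarrow> real"
      and \<Omega> :: "'b measure" and X :: "'b \<Rightarrow> 'a"
  proof -
    define R where "R = scale_measure (1 / 2) (measure_add P Q)"
    define w where "w x = max (- 1) (min 1 (u x))" for x
    note rep = tilt_representation[OF P Q sets u, folded R_def w_def]
    interpret symmetric_tilt R w
      by (rule rep(1))
    have u_meas [measurable]: "u \<in> borel_measurable P"
      using u by (auto simp: RN_deriv_diff_def dest: borel_measurable_integrable)
    have u_measR [measurable]: "u \<in> borel_measurable R"
      using u_meas by (simp add: R_def)
    have "prob_space.expectation \<Omega> (\<lambda>\<omega>. min ((u (X \<omega>))\<^sup>2) (\<delta> * \<bar>u (X \<omega>)\<bar>))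
      = (\<integral>x. min ((u x)\<^sup>2) (\<delta> * \<bar>u x\<bar>) \<partial>distr \<Omega> P X)"
      by (subst integral_distr) auto
    also have "\<dots> = (\<integral>x. min ((u x)\<^sup>2) (\<delta> * \<bar>u x\<bar>) \<partial>R)"
      by (simp only: distr R_def)
    also have "\<dots> = capped_energy R \<delta> w"
      unfolding capped_energy_def using rep(4) by (intro integral_cong_AE) auto
    finally have energy: "prob_space.expectation \<Omega> (\<lambda>\<omega>. min ((u (X \<omega>))\<^sup>2) (\<delta> * \<bar>u (X \<omega>)\<bar>))
      = capped_energy R \<delta> w" .
    have "capped_energy R \<delta> w \<noteq> 0"
      using tilt_eq_if_no_energy[OF \<delta>(1)] neq rep(2,3) by metis
    then have V: "0 < capped_energy R \<delta> w"
      using capped_energy_nonneg[of \<delta>] \<delta> by simp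
    show ?thesis
      using sample_complexity_bounds[OF \<delta> V] unfolding Let_def energy rep(2,3)[symmetric] by blast
  qed
  show ?thesis
    by (rule bexI[of _ "1 / 100"], rule bexI[of _ 201])
      (use bounds in \<open>auto simp: universal_range_def\<close>)
qed

end
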